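(* $\mathrm{EST}+\mathrm{VP}+\Delta_0$-Replacement proves the Powerset axiom. Consequently $\mathrm{EST}+\mathrm{VP}$ proves the Powerset axiom.
   Context: All theories are in the language $\{\in\}$. EST is the theory with the axioms: Extensionality, Empty Set, Pairing, Union, Cartesian Product (for all sets $x,y$, $x\times y$ is a set), $\Delta_0$-Separation, and the Induction scheme along $\omega$: with $\mathrm{Ord}(x)$ meaning "$x$ is transitive and linearly ordered by $\in$ (trichotomy)", $\mathrm{Nat}(x)$ meaning $\mathrm{Ord}(x)$ and every $y\in x\cup\{x\}$ is $\emptyset$ or of the form $z\cup\{z\}$ with $z\in y$, and $\omega=\{x:\mathrm{Nat}(x)\}$ (a class), for each formula $\phi$ with $\phi(x)\to\mathrm{Nat}(x)$: $[\phi(\emptyset)\wedge(\forall x\in\omega)(\phi(x)\to\phi(x\cup\{x\}))]\to(\forall x\in\omega)\phi(x)$. $\Delta_0$-Replacement is Replacement restricted to $\Delta_0$ formulas. For a formula $\phi(x)$, $X_\phi=\{x:\phi(x)\}$; "$X_\phi$ is a proper class" means $(\forall x)(\exists y)[(\phi(y)\wedge y\notin x)\vee(\neg\phi(y)\wedge y\in x)]$. For a set $A$, $L_A$ is the first-order language with equality, a unary predicate $\mathbf U$, a binary predicate $\mathbf R$ (either may be omitted) and a constant $\mathbf c_a$ for each $a\in A$ (coded as sets in the standard way). An $L_A$-structure is $\langle M,U,R,I\rangle$ with $U\subseteq M$, $R\subseteq M\times M$, $I:A\to M$ a function interpreting $\mathbf c_a$ as $I(a)$; satisfaction and elementary embeddings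 are defined as usual. VP is the scheme: for every formula $\phi(x)$ and every set $A$, if $X_\phi$ is a proper class of $L_A$-structures, then there are distinct $\mathcal M,\mathcal N\in X_\phi$ and an elementary embedding $f:\mathcal M\to\mathcal N$. *)

theory Defs
  imports Main
begin

section \<open>First-order logic over the language of one binary relation\<close>

text \<open>Formulas use de Bruijn indices. Variables are the only terms, so substitution is renaming.\<close>

datatype fm =
    Mem nat nat
  | Eq nat nat
  | Falsum
  | Imp fm fm
  | Forall fm

definition Neg :: "fm \<Rightarrow> fm" where "Neg p = Imp p Falsum"
definition Or :: "fm \<Rightarrow> fm \<Rightarrow> fm" where "Or p q = Imp (Neg p) q"
definition And :: "fm \<Rightarrow> fm \<Rightarrow> fm" where "And p q = Neg (Imp p (Neg q))"
definition Iff :: "fm \<Rightarrow> fm \<Rightarrow> fm" where "Iff p q = And (Imp p q) (Imp q p)"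
definition Exists :: "fm \<Rightarrow> fm" where "Exists p = Neg (Forall (Neg p))"

primrec rename :: "(nat \<Rightarrow> nat) \<Rightarrow> fm \<Rightarrow> fm" where
  "rename f (Mem x y) = Mem (f x) (f y)"
| "rename f (Eq x y) = Eq (f x) (f y)"
| "rename f Falsum = Falsum"
| "rename f (Imp p q) = Imp (rename f p) (rename f q)"
| "rename f (Forall p) = Forall (rename (case_nat 0 (\<lambda>i. Suc (f i))) p)"

text \<open>\<open>scope n p\<close>: all free variables of \<open>p\<close> have index below \<open>n\<close>.\<close>

primrec scope :: "nat \<Rightarrow> fm \<Rightarrow> bool" where
  "scope n (Mem x y) \<longleftrightarrow> x < n \<and> y < n"
| "scope n (Eq x y) \<longleftrightarrow> x < n \<and> y < n"
| "scope n Falsum \<longleftrightarrow> True"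
| "scope n (Imp p q) \<longleftrightarrow> scope n p \<and> scope n q"
| "scope n (Forall p) \<longleftrightarrow> scope (Suc n) p"

text \<open>Classical natural deduction with equality; \<open>case_nat t id\<close> replaces variable 0 by \<open>t\<close> and
  lowers the remaining indices.\<close>

inductive proves :: "fm set \<Rightarrow> fm \<Rightarrow> bool" (infix "\<turnstile>" 50) where
  Assm: "p \<in> G \<Longrightarrow> G \<turnstile> p"
| ImpI: "insert p G \<turnstile> q \<Longrightarrow> G \<turnstile> Imp p q"
| ImpE: "G \<turnstile> Imp p q \<Longrightarrow> G \<turnstile> p \<Longrightarrow> G \<turnstile> q"
| Contr: "insert (Neg p) G \<turnstile> Falsum \<Longrightarrow> G \<turnstile> p"
| ForallI: "rename Suc ` G \<turnstile> p \<Longrightarrow> G \<turnstile> Forall p"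
| ForallE: "G \<turnstile> Forall p \<Longrightarrow> G \<turnstile> rename (case_nat t id) p"
| EqI: "G \<turnstile> Eq x x"
| EqE: "G \<turnstile> Eq x y \<Longrightarrow> G \<turnstile> rename (case_nat x id) p \<Longrightarrow> G \<turnstile> rename (case_nat y id) p"

inductive delta0 :: "fm \<Rightarrow> bool" where
  "delta0 (Mem x y)"
| "delta0 (Eq x y)"
| "delta0 Falsum"
| "delta0 p \<Longrightarrow> delta0 q \<Longrightarrow> delta0 (Imp p q)"
| "delta0 p \<Longrightarrow> delta0 (Forall (Imp (Mem 0 (Suc y)) p))"
| "delta0 p \<Longrightarrow> delta0 (Exists (And (Mem 0 (Suc y)) p))"


section \<open>Notation for writing formulas with bound names\<close>

text \<open>
  A \<open>form\<close> yields a formula for each number \<open>d\<close> of enclosing quantifiers. A variable is denoted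
  by its de Bruijn level (the number of quantifiers outside its binder); level \<open>x\<close> at depth \<open>d\<close> is
  the index \<open>d - Suc x\<close>. This lets object-level quantifiers be written with HOL-bound names.
\<close>

type_synonym form = "nat \<Rightarrow> fm"

definition fMem :: "nat \<Rightarrow> nat \<Rightarrow> form" (infix "\<^bold>\<in>" 50)
  where "(x \<^bold>\<in> y) = (\<lambda>d. Mem (d - Suc x) (d - Suc y))"
definition fEq :: "nat \<Rightarrow> nat \<Rightarrow> form" (infix "\<^bold>=" 50)
  where "(x \<^bold>= y) = (\<lambda>d. Eq (d - Suc x) (d - Suc y))"
definition fFalse :: form ("\<^bold>\<bottom>")
  where "\<^bold>\<bottom> = (\<lambda>d. Falsum)"
definition fNot :: "form \<Rightarrow> form" ("\<^bold>\<not> _" [40] 40)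
  where "(\<^bold>\<not> P) = (\<lambda>d. Neg (P d))"
definition fAnd :: "form \<Rightarrow> form \<Rightarrow> form" (infixr "\<^bold>\<and>" 35)
  where "(P \<^bold>\<and> Q) = (\<lambda>d. And (P d) (Q d))"
definition fOr :: "form \<Rightarrow> form \<Rightarrow> form" (infixr "\<^bold>\<or>" 30)
  where "(P \<^bold>\<or> Q) = (\<lambda>d. Or (P d) (Q d))"
definition fImp :: "form \<Rightarrow> form \<Rightarrow> form" (infixr "\<^bold>\<longrightarrow>" 25)
  where "(P \<^bold>\<longrightarrow> Q) = (\<lambda>d. Imp (P d) (Q d))"
definition fIff :: "form \<Rightarrow> form \<Rightarrow> form" (infixr "\<^bold>\<longleftrightarrow>" 25)
  where "(P \<^bold>\<longleftrightarrow> Q) = (\<lambda>d. Iff (P d) (Q d))"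
definition fAll :: "(nat \<Rightarrow> form) \<Rightarrow> form" (binder "\<^bold>\<forall>" 10)
  where "fAll P = (\<lambda>d. Forall (P d (Suc d)))"
definition fEx :: "(nat \<Rightarrow> form) \<Rightarrow> form" (binder "\<^bold>\<exists>" 10)
  where "fEx P = (\<lambda>d. Exists (P d (Suc d)))"

text \<open>
  \<open>univ n P\<close> quantifies \<open>P\<close> universally over \<open>n\<close> parameters, which have levels \<open>0, \<dots>, n - 1\<close>.
  \<open>inst p xs\<close> is the formula \<open>p\<close> with its variables \<open>0, \<dots>, length xs - 1\<close> replaced by \<open>xs\<close> and its
  variable \<open>length xs + j\<close> replaced by the \<open>j\<close>-th parameter; so for \<open>scope (length xs + n) p\<close>,
  \<open>univ n\<close> binds all parameters of \<open>p\<close>.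
\<close>

definition univ :: "nat \<Rightarrow> form \<Rightarrow> fm" where
  "univ n P = (Forall ^^ n) (P n)"

definition inst :: "fm \<Rightarrow> nat list \<Rightarrow> form" where
  "inst p xs = (\<lambda>d. rename (\<lambda>i. d - Suc (if i < length xs then xs ! i else i - length xs)) p)"


section \<open>Elementary set-theoretic notions\<close>

definition is_subset :: "nat \<Rightarrow> nat \<Rightarrow> form" where
  "is_subset x y = (\<^bold>\<forall>z. z \<^bold>\<in> x \<^bold>\<longrightarrow> z \<^bold>\<in> y)"

definition is_empty :: "nat \<Rightarrow> form" where
  "is_empty x = (\<^bold>\<forall>z. \<^bold>\<not> z \<^bold>\<in> x)"

definition is_upair :: "nat \<Rightarrow> nat \<Rightarrow> nat \<Rightarrow> form" where
  "is_upair p x y = (\<^bold>\<forall>z. z \<^bold>\<in> p \<^bold>\<longleftrightarrow> z \<^bold>= x \<^bold>\<or> z \<^bold>= y)"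

definition is_pair :: "nat \<Rightarrow> nat \<Rightarrow> nat \<Rightarrow> form" where
  "is_pair p x y = (\<^bold>\<exists>u v. is_upair u x x \<^bold>\<and> is_upair v x y \<^bold>\<and> is_upair p u v)"

definition pair_in :: "nat \<Rightarrow> nat \<Rightarrow> nat \<Rightarrow> form" where
  "pair_in x y r = (\<^bold>\<exists>p. is_pair p x y \<^bold>\<and> p \<^bold>\<in> r)"

text \<open>\<open>is_succ y x\<close>: \<open>y = x \<union> {x}\<close>.\<close>

definition is_succ :: "nat \<Rightarrow> nat \<Rightarrow> form" where
  "is_succ y x = (\<^bold>\<forall>z. z \<^bold>\<in> y \<^bold>\<longleftrightarrow> z \<^bold>\<in> x \<^bold>\<or> z \<^bold>= x)"

definition is_Ord :: "nat \<Rightarrow> form" where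
  "is_Ord x =
    ((\<^bold>\<forall>y. y \<^bold>\<in> x \<^bold>\<longrightarrow> is_subset y x)
     \<^bold>\<and> (\<^bold>\<forall>y. y \<^bold>\<in> x \<^bold>\<longrightarrow> \<^bold>\<not> y \<^bold>\<in> y)
     \<^bold>\<and> (\<^bold>\<forall>y z w. y \<^bold>\<in> x \<^bold>\<and> z \<^bold>\<in> x \<^bold>\<and> w \<^bold>\<in> x \<^bold>\<and> y \<^bold>\<in> z \<^bold>\<and> z \<^bold>\<in> w \<^bold>\<longrightarrow> y \<^bold>\<in> w)
     \<^bold>\<and> (\<^bold>\<forall>y z. y \<^bold>\<in> x \<^bold>\<and> z \<^bold>\<in> x \<^bold>\<longrightarrow> y \<^bold>\<in> z \<^bold>\<or> y \<^bold>= z \<^bold>\<or> z \<^bold>\<in> y))"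

definition is_Nat :: "nat \<Rightarrow> form" where
  "is_Nat x =
    (is_Ord x \<^bold>\<and>
     (\<^bold>\<forall>y. y \<^bold>\<in> x \<^bold>\<or> y \<^bold>= x \<^bold>\<longrightarrow> is_empty y \<^bold>\<or> (\<^bold>\<exists>z. z \<^bold>\<in> y \<^bold>\<and> is_succ y z)))"

definition is_rel :: "nat \<Rightarrow> nat \<Rightarrow> nat \<Rightarrow> form" where
  "is_rel r X Y = (\<^bold>\<forall>p. p \<^bold>\<in> r \<^bold>\<longrightarrow> (\<^bold>\<exists>x y. x \<^bold>\<in> X \<^bold>\<and> y \<^bold>\<in> Y \<^bold>\<and> is_pair p x y))"

definition is_fun :: "nat \<Rightarrow> nat \<Rightarrow> nat \<Rightarrow> form" where
  "is_fun f X Y =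
    (is_rel f X Y \<^bold>\<and>
     (\<^bold>\<forall>x. x \<^bold>\<in> X \<^bold>\<longrightarrow> (\<^bold>\<exists>y. pair_in x y f \<^bold>\<and> (\<^bold>\<forall>z. pair_in x z f \<^bold>\<longrightarrow> z \<^bold>= y))))"


section \<open>The theory EST, Replacement and Powerset\<close>

definition Extensionality :: fm where
  "Extensionality = (\<^bold>\<forall>x y. (\<^bold>\<forall>z. z \<^bold>\<in> x \<^bold>\<longleftrightarrow> z \<^bold>\<in> y) \<^bold>\<longrightarrow> x \<^bold>= y) 0"

definition Empty_Set :: fm where
  "Empty_Set = (\<^bold>\<exists>x. is_empty x) 0"

definition Pairing :: fm where
  "Pairing = (\<^bold>\<forall>x y. \<^bold>\<exists>p. is_upair p x y) 0"

definition Union_Axiom :: fm where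
  "Union_Axiom = (\<^bold>\<forall>x. \<^bold>\<exists>y. \<^bold>\<forall>z. z \<^bold>\<in> y \<^bold>\<longleftrightarrow> (\<^bold>\<exists>w. w \<^bold>\<in> x \<^bold>\<and> z \<^bold>\<in> w)) 0"

definition Cartesian_Product :: fm where
  "Cartesian_Product =
    (\<^bold>\<forall>x y. \<^bold>\<exists>z. \<^bold>\<forall>p. p \<^bold>\<in> z \<^bold>\<longleftrightarrow> (\<^bold>\<exists>a b. a \<^bold>\<in> x \<^bold>\<and> b \<^bold>\<in> y \<^bold>\<and> is_pair p a b)) 0"

definition Separation :: "nat \<Rightarrow> fm \<Rightarrow> fm" where
  "Separation n p =
    univ n (\<^bold>\<forall>a. \<^bold>\<exists>b. \<^bold>\<forall>x. x \<^bold>\<in> b \<^bold>\<longleftrightarrow> x \<^bold>\<in> a \<^bold>\<and> inst p [x])"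

definition Nat_Induction :: "nat \<Rightarrow> fm \<Rightarrow> fm" where
  "Nat_Induction n p =
    univ n
     ((\<^bold>\<forall>x. inst p [x] \<^bold>\<longrightarrow> is_Nat x) \<^bold>\<longrightarrow>
      (\<^bold>\<forall>x. is_empty x \<^bold>\<longrightarrow> inst p [x])
        \<^bold>\<and> (\<^bold>\<forall>x. is_Nat x \<^bold>\<longrightarrow> inst p [x] \<^bold>\<longrightarrow> (\<^bold>\<forall>y. is_succ y x \<^bold>\<longrightarrow> inst p [y])) \<^bold>\<longrightarrow>
      (\<^bold>\<forall>x. is_Nat x \<^bold>\<longrightarrow> inst p [x]))"

definition EST :: "fm set" where
  "EST =
    {Extensionality, Empty_Set, Pairing, Union_Axiom, Cartesian_Product}
    \<union> {Separation n p | n p. delta0 p \<and> scope (Suc n) p}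
    \<union> {Nat_Induction n p | n p. scope (Suc n) p}"

definition Replacement :: "nat \<Rightarrow> fm \<Rightarrow> fm" where
  "Replacement n p =
    univ n
     (\<^bold>\<forall>a. (\<^bold>\<forall>x. x \<^bold>\<in> a \<^bold>\<longrightarrow> (\<^bold>\<exists>y. inst p [x, y] \<^bold>\<and> (\<^bold>\<forall>z. inst p [x, z] \<^bold>\<longrightarrow> z \<^bold>= y))) \<^bold>\<longrightarrow>
       (\<^bold>\<exists>b. \<^bold>\<forall>y. y \<^bold>\<in> b \<^bold>\<longleftrightarrow> (\<^bold>\<exists>x. x \<^bold>\<in> a \<^bold>\<and> inst p [x, y])))"

definition Delta0_Replacement :: "fm set" where
  "Delta0_Replacement = {Replacement n p | n p. delta0 p \<and> scope (Suc (Suc n)) p}"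

definition Powerset :: fm where
  "Powerset = (\<^bold>\<forall>x. \<^bold>\<exists>y. \<^bold>\<forall>z. z \<^bold>\<in> y \<^bold>\<longleftrightarrow> is_subset z x) 0"


section \<open>Internal syntax and semantics of the languages $L_A$\<close>

text \<open>
  The flags \<open>u\<close> and \<open>r\<close> say whether the predicates \<open>U\<close> and \<open>R\<close> belong to the language.
  Codes, where the tags are von Neumann numerals:
  the variable $v_i$ is $\langle 0,i\rangle$ and the constant $c_a$ is $\langle 1,a\rangle$;
  $s = t$ is $\langle 0,\langle s,t\rangle\rangle$, $U(t)$ is $\langle 1,t\rangle$,
  $R(s,t)$ is $\langle 2,\langle s,t\rangle\rangle$, $\neg\psi$ is $\langle 3,\psi\rangle$,
  $\psi\wedge\chi$ is $\langle 4,\langle\psi,\chi\rangle\rangle$ and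
  $\exists v_i\,\psi$ is $\langle 5,\langle i,\psi\rangle\rangle$.
\<close>

primrec is_num :: "nat \<Rightarrow> nat \<Rightarrow> form" where
  "is_num 0 x = is_empty x"
| "is_num (Suc k) x = (\<^bold>\<exists>y. is_num k y \<^bold>\<and> is_succ x y)"

definition is_tagged :: "nat \<Rightarrow> nat \<Rightarrow> nat \<Rightarrow> form" where
  "is_tagged k c x = (\<^bold>\<exists>t. is_num k t \<^bold>\<and> is_pair c t x)"

definition is_tagged2 :: "nat \<Rightarrow> nat \<Rightarrow> nat \<Rightarrow> nat \<Rightarrow> form" where
  "is_tagged2 k c x y = (\<^bold>\<exists>p. is_pair p x y \<^bold>\<and> is_tagged k c p)"

definition code_var :: "nat \<Rightarrow> nat \<Rightarrow> form" where "code_var = is_tagged 0"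
definition code_const :: "nat \<Rightarrow> nat \<Rightarrow> form" where "code_const = is_tagged 1"

definition code_eq :: "nat \<Rightarrow> nat \<Rightarrow> nat \<Rightarrow> form" where "code_eq = is_tagged2 0"
definition code_U :: "nat \<Rightarrow> nat \<Rightarrow> form" where "code_U = is_tagged 1"
definition code_R :: "nat \<Rightarrow> nat \<Rightarrow> nat \<Rightarrow> form" where "code_R = is_tagged2 2"
definition code_neg :: "nat \<Rightarrow> nat \<Rightarrow> form" where "code_neg = is_tagged 3"
definition code_conj :: "nat \<Rightarrow> nat \<Rightarrow> nat \<Rightarrow> form" where "code_conj = is_tagged2 4"
definition code_ex :: "nat \<Rightarrow> nat \<Rightarrow> nat \<Rightarrow> form" where "code_ex = is_tagged2 5"

text \<open>Terms and formulas are considered relative to a bound \<open>k \<in> \<omega>\<close>: only the variables $v_i$ with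
  $i < k$ occur, free or bound, so that assignments can be taken to be functions from \<open>k\<close>.\<close>

definition is_term :: "nat \<Rightarrow> nat \<Rightarrow> nat \<Rightarrow> form" where
  "is_term A k t =
    ((\<^bold>\<exists>i. i \<^bold>\<in> k \<^bold>\<and> code_var t i) \<^bold>\<or> (\<^bold>\<exists>a. a \<^bold>\<in> A \<^bold>\<and> code_const t a))"

definition is_atomic :: "bool \<Rightarrow> bool \<Rightarrow> nat \<Rightarrow> nat \<Rightarrow> nat \<Rightarrow> form" where
  "is_atomic u r A k c =
    ((\<^bold>\<exists>s t. is_term A k s \<^bold>\<and> is_term A k t \<^bold>\<and> code_eq c s t)
     \<^bold>\<or> (if u then \<^bold>\<exists>t. is_term A k t \<^bold>\<and> code_U c t else \<^bold>\<bottom>)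
     \<^bold>\<or> (if r then \<^bold>\<exists>s t. is_term A k s \<^bold>\<and> is_term A k t \<^bold>\<and> code_R c s t else \<^bold>\<bottom>))"

text \<open>\<open>g\<close> is a formation sequence of length \<open>n \<in> \<omega>\<close>: every entry is atomic or built from earlier ones.\<close>

definition is_formation :: "bool \<Rightarrow> bool \<Rightarrow> nat \<Rightarrow> nat \<Rightarrow> nat \<Rightarrow> nat \<Rightarrow> form" where
  "is_formation u r A k n g =
    (is_Nat n \<^bold>\<and> (\<^bold>\<exists>Y. is_fun g n Y) \<^bold>\<and>
     (\<^bold>\<forall>j c. pair_in j c g \<^bold>\<longrightarrow>
        is_atomic u r A k c
        \<^bold>\<or> (\<^bold>\<exists>i d. i \<^bold>\<in> j \<^bold>\<and> pair_in i d g \<^bold>\<and> code_neg c d)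
        \<^bold>\<or> (\<^bold>\<exists>i d i' d'. i \<^bold>\<in> j \<^bold>\<and> pair_in i d g \<^bold>\<and> i' \<^bold>\<in> j \<^bold>\<and> pair_in i' d' g \<^bold>\<and> code_conj c d d')
        \<^bold>\<or> (\<^bold>\<exists>i d v. i \<^bold>\<in> j \<^bold>\<and> pair_in i d g \<^bold>\<and> v \<^bold>\<in> k \<^bold>\<and> code_ex c v d)))"

definition is_formula :: "bool \<Rightarrow> bool \<Rightarrow> nat \<Rightarrow> nat \<Rightarrow> nat \<Rightarrow> form" where
  "is_formula u r A k c = (\<^bold>\<exists>n g j. is_formation u r A k n g \<^bold>\<and> pair_in j c g)"

text \<open>\<open>S\<close> codes the \<open>L\<^sub>A\<close>-structure with universe \<open>M\<close>, predicates \<open>U\<close>, \<open>R\<close> and interpretation \<open>I\<close> of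
  the constants. Tuples associate to the right. A predicate missing from the language is missing from
  the tuple, and the corresponding variable is then fixed to be empty as a dummy.\<close>

definition is_structure ::
  "bool \<Rightarrow> bool \<Rightarrow> nat \<Rightarrow> nat \<Rightarrow> nat \<Rightarrow> nat \<Rightarrow> nat \<Rightarrow> nat \<Rightarrow> form" where
  "is_structure u r A S M U R I =
    ((if u then
        (if r then \<^bold>\<exists>p q. is_pair S M p \<^bold>\<and> is_pair p U q \<^bold>\<and> is_pair q R I
         else \<^bold>\<exists>p. is_pair S M p \<^bold>\<and> is_pair p U I)
      else
        (if r then \<^bold>\<exists>p. is_pair S M p \<^bold>\<and> is_pair p R I
         else is_pair S M I))
     \<^bold>\<and> (\<^bold>\<exists>m. m \<^bold>\<in> M)
     \<^bold>\<and> (if u then is_subset U M else is_empty U)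
     \<^bold>\<and> (if r then is_rel R M M else is_empty R)
     \<^bold>\<and> is_fun I A M)"

definition is_L_structure :: "bool \<Rightarrow> bool \<Rightarrow> nat \<Rightarrow> nat \<Rightarrow> form" where
  "is_L_structure u r A S = (\<^bold>\<exists>M U R I. is_structure u r A S M U R I)"



definition denotes :: "nat \<Rightarrow> nat \<Rightarrow> nat \<Rightarrow> nat \<Rightarrow> form" where
  "denotes I s t m =
    ((\<^bold>\<exists>i. code_var t i \<^bold>\<and> pair_in i m s) \<^bold>\<or> (\<^bold>\<exists>a. code_const t a \<^bold>\<and> pair_in a m I))"

text \<open>\<open>s' : k \<rightarrow> M\<close> agrees with \<open>s\<close> except that it maps \<open>i\<close> to \<open>m\<close>.\<close>

definition is_update :: "nat \<Rightarrow> nat \<Rightarrow> nat \<Rightarrow> nat \<Rightarrow> nat \<Rightarrow> nat \<Rightarrow> form" where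
  "is_update k M s' s i m =
    (is_fun s' k M \<^bold>\<and> pair_in i m s' \<^bold>\<and>
     (\<^bold>\<forall>j x. \<^bold>\<not> j \<^bold>= i \<^bold>\<and> pair_in j x s \<^bold>\<longrightarrow> pair_in j x s'))"

text \<open>Tarski's clauses: among the pairs \<open>\<langle>c, s\<rangle>\<close> with \<open>c\<close> an entry of \<open>g\<close> and \<open>s : k \<rightarrow> M\<close>, \<open>T\<close>
  contains exactly those for which \<open>s\<close> satisfies \<open>c\<close>.\<close>

definition is_sat_set :: "nat \<Rightarrow> nat \<Rightarrow> nat \<Rightarrow> nat \<Rightarrow> nat \<Rightarrow> nat \<Rightarrow> nat \<Rightarrow> form" where
  "is_sat_set M U R I k g T =
    (\<^bold>\<forall>j c s. pair_in j c g \<^bold>\<and> is_fun s k M \<^bold>\<longrightarrow>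
      (pair_in c s T \<^bold>\<longleftrightarrow>
        (\<^bold>\<exists>t t' m. code_eq c t t' \<^bold>\<and> denotes I s t m \<^bold>\<and> denotes I s t' m)
        \<^bold>\<or> (\<^bold>\<exists>t m. code_U c t \<^bold>\<and> denotes I s t m \<^bold>\<and> m \<^bold>\<in> U)
        \<^bold>\<or> (\<^bold>\<exists>t t' m m'. code_R c t t' \<^bold>\<and> denotes I s t m \<^bold>\<and> denotes I s t' m' \<^bold>\<and> pair_in m m' R)
        \<^bold>\<or> (\<^bold>\<exists>d. code_neg c d \<^bold>\<and> \<^bold>\<not> pair_in d s T)
        \<^bold>\<or> (\<^bold>\<exists>d d'. code_conj c d d' \<^bold>\<and> pair_in d s T \<^bold>\<and> pair_in d' s T)
        \<^bold>\<or> (\<^bold>\<exists>i d m s'. code_ex c i d \<^bold>\<and> m \<^bold>\<in> M \<^bold>\<and> is_update k M s' s i m \<^bold>\<and> pair_in d s' T)))"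

definition satisfies ::
  "bool \<Rightarrow> bool \<Rightarrow> nat \<Rightarrow> nat \<Rightarrow> nat \<Rightarrow> nat \<Rightarrow> nat \<Rightarrow> nat \<Rightarrow> nat \<Rightarrow> nat \<Rightarrow> form" where
  "satisfies u r A M U R I k c s =
    (\<^bold>\<exists>n g j T. is_formation u r A k n g \<^bold>\<and> pair_in j c g
       \<^bold>\<and> is_sat_set M U R I k g T \<^bold>\<and> pair_in c s T)"

definition is_elementary :: "bool \<Rightarrow> bool \<Rightarrow> nat \<Rightarrow> nat \<Rightarrow> nat \<Rightarrow> nat \<Rightarrow> form" where
  "is_elementary u r A f S S' =
    (\<^bold>\<exists>M U R I M' U' R' I'.
       is_structure u r A S M U R I \<^bold>\<and> is_structure u r A S' M' U' R' I' \<^bold>\<and> is_fun f M M' \<^bold>\<and>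
       (\<^bold>\<forall>k c s s'.
          is_Nat k \<^bold>\<and> is_formula u r A k c \<^bold>\<and> is_fun s k M \<^bold>\<and> is_fun s' k M'
            \<^bold>\<and> (\<^bold>\<forall>i m m'. pair_in i m s \<^bold>\<and> pair_in m m' f \<^bold>\<longrightarrow> pair_in i m' s') \<^bold>\<longrightarrow>
          (satisfies u r A M U R I k c s \<^bold>\<longleftrightarrow> satisfies u r A M' U' R' I' k c s')))"


section \<open>Vopenka's Principle\<close>

definition is_proper_class :: "(nat \<Rightarrow> form) \<Rightarrow> form" where
  "is_proper_class P =
    (\<^bold>\<forall>x. \<^bold>\<exists>y. (P y \<^bold>\<and> \<^bold>\<not> y \<^bold>\<in> x) \<^bold>\<or> (\<^bold>\<not> P y \<^bold>\<and> y \<^bold>\<in> x))"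

definition Vopenka :: "bool \<Rightarrow> bool \<Rightarrow> nat \<Rightarrow> fm \<Rightarrow> fm" where
  "Vopenka u r n p =
    univ n
     (\<^bold>\<forall>A. is_proper_class (\<lambda>x. inst p [x]) \<^bold>\<and> (\<^bold>\<forall>x. inst p [x] \<^bold>\<longrightarrow> is_L_structure u r A x) \<^bold>\<longrightarrow>
       (\<^bold>\<exists>S S'. \<^bold>\<not> S \<^bold>= S' \<^bold>\<and> inst p [S] \<^bold>\<and> inst p [S'] \<^bold>\<and> (\<^bold>\<exists>f. is_elementary u r A f S S')))"

definition VP :: "fm set" where
  "VP = {Vopenka u r n p | u r n p. scope (Suc n) p}"

end

theory Submission
  imports Defs "HOL-Library.Countable"
begin

text \<open>
  By the completeness theorem it suffices to argue inside an arbitrary model. For a nonempty set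
  \<open>a\<close>, let \<open>S\<^sub>x = \<langle>a, x, id\<rangle>\<close> for \<open>x \<subseteq> a\<close>, a structure for the language with the predicate \<open>U\<close> and
  a constant for each element of \<open>a\<close>. An elementary embedding of \<open>S\<^sub>x\<close> into \<open>S\<^sub>y\<close> preserves the truth
  of each sentence \<open>U(c\<^sub>b)\<close>, which says \<open>b \<in> x\<close> in \<open>S\<^sub>x\<close> and \<open>b \<in> y\<close> in \<open>S\<^sub>y\<close>, so \<open>x = y\<close>. By VP
  the structures \<open>S\<^sub>x\<close> therefore form a set \<open>Z\<close>, and the power set of \<open>a\<close> is separated from a
  fourfold union of \<open>Z\<close>. The sentences \<open>U(c\<^sub>b)\<close> are atomic and have no variables, so their
  satisfaction sets exist by Pairing alone.
\<close>

section \<open>Completeness\<close>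

lemma rename_rename: "rename f (rename g p) = rename (f \<circ> g) p"
proof (induction p arbitrary: f g)
  case (Forall p)
  have "case_nat 0 (\<lambda>i. Suc (f i)) \<circ> case_nat 0 (\<lambda>i. Suc (g i)) = case_nat 0 (\<lambda>i. Suc ((f \<circ> g) i))"
    by (auto simp: fun_eq_iff split: nat.split)
  then show ?case by (simp add: Forall)
qed auto

lemma rename_id: "(\<And>i. f i = i) \<Longrightarrow> rename f p = p"
proof (induction p arbitrary: f)
  case (Forall p)
  have "rename (case_nat 0 (\<lambda>i. Suc (f i))) p = p"
    by (rule Forall.IH) (simp add: Forall.prems split: nat.split)
  then show ?case by simp
qed auto

lemma rename_Neg [simp]: "rename f (Neg p) = Neg (rename f p)"
  by (simp add: Neg_def)

text \<open>Both composite maps send index 0 to \<open>f t\<close> and index \<open>Suc i\<close> to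
  \<open>f i\<close>. The \<open>ForallE\<close> and \<open>EqE\<close> cases of
  \<open>proves_rename\<close> rest on this.\<close>

lemma rename_subst:
  "rename f (rename (case_nat t id) p) =
     rename (case_nat (f t) id) (rename (case_nat 0 (\<lambda>i. Suc (f i))) p)"
  unfolding rename_rename
  by (rule arg_cong[where f = "\<lambda>h. rename h p"]) (auto simp: fun_eq_iff split: nat.split)

lemma proves_mono: "G \<turnstile> p \<Longrightarrow> G \<subseteq> H \<Longrightarrow> H \<turnstile> p"
proof (induction arbitrary: H rule: proves.induct)
  case (ImpI p G q) then show ?case by (meson insert_mono proves.ImpI)
next
  case (Contr p G) then show ?case by (meson insert_mono proves.Contr)
next
  case (ForallI G p) then show ?case by (meson image_mono proves.ForallI)
qed (blast intro: proves.intros)+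

text \<open>Induction on the derivation. At \<open>ForallI\<close> the hypothesis is applied to the
  renaming lifted past the binder, which acts on the shifted context as \<open>f\<close> followed by
  the shift.\<close>

lemma proves_rename: "G \<turnstile> p \<Longrightarrow> rename f ` G \<turnstile> rename f p"
proof (induction arbitrary: f rule: proves.induct)
  case (ForallI G p)
  have "rename (case_nat 0 (\<lambda>i. Suc (f i))) ` rename Suc ` G = rename Suc ` rename f ` G"
    unfolding image_image rename_rename
    by (rule image_cong[OF refl], rule arg_cong[where f = "\<lambda>h. rename h _"]) (auto simp: fun_eq_iff)
  then show ?case using ForallI.IH[of "case_nat 0 (\<lambda>i. Suc (f i))"]
    by (simp add: proves.ForallI)
next
  case (ForallE G p t)
  then show ?case unfolding rename_subst by (metis rename.simps(5) proves.ForallE)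
next
  case (EqE G x y p)
  then show ?case unfolding rename_subst by (metis rename.simps(2) proves.EqE)
next
  case (Contr p G)
  then show ?case by (metis image_insert proves.Contr rename.simps(3) rename_Neg)
next
  case (ImpE G p q)
  then show ?case by (metis rename.simps(4) proves.ImpE)
qed (auto intro: proves.intros)

text \<open>A derivation is a finite tree and so uses finitely many assumptions. This carries
  consistency over to the union of a chain.\<close>

lemma proves_finite: "G \<turnstile> p \<Longrightarrow> \<exists>F. finite F \<and> F \<subseteq> G \<and> F \<turnstile> p"
proof (induction rule: proves.induct)
  case (Assm p G)
  then show ?case by (intro exI[of _ "{p}"]) (auto intro: proves.Assm)
next
  case (ImpI p G q)
  then obtain F where "finite F" "F \<subseteq> insert p G" "F \<turnstile> q" by blast
  then show ?case
    by (intro exI[of _ "F - {p}"]) (auto intro!: proves.ImpI elim: proves_mono)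
next
  case (ImpE G p q)
  then obtain F F' where "finite F" "F \<subseteq> G" "F \<turnstile> Imp p q" "finite F'" "F' \<subseteq> G" "F' \<turnstile> p" by blast
  then show ?case
    by (intro exI[of _ "F \<union> F'"]) (auto intro: proves.ImpE proves_mono)
next
  case (Contr p G)
  then obtain F where F: "finite F" "F \<subseteq> insert (Neg p) G" "F \<turnstile> Falsum" by blast
  have "F - {Neg p} \<turnstile> p"
    by (rule proves.Contr, rule proves_mono[OF F(3)]) auto
  then show ?case using F(1,2) by (intro exI[of _ "F - {Neg p}"]) auto
next
  case (ForallI G p)
  then obtain F where "finite F" "F \<subseteq> rename Suc ` G" "F \<turnstile> p" by blast
  then show ?case by (metis finite_subset_image proves.ForallI)
next
  case (EqE G x y p)
  then obtain F F' where "finite F" "F \<subseteq> G" "F \<turnstile> Eq x y" "finite F'" "F' \<subseteq> G"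
      "F' \<turnstile> rename (case_nat x id) p"
    by blast
  then show ?case
    by (intro exI[of _ "F \<union> F'"]) (auto intro: proves.EqE proves_mono)
qed (blast intro: proves.intros)+

lemma proves_cut: "G \<turnstile> p \<Longrightarrow> insert p G \<turnstile> q \<Longrightarrow> G \<turnstile> q"
  by (blast intro: proves.ImpI proves.ImpE)

lemma proves_NegI: "insert p G \<turnstile> Falsum \<Longrightarrow> G \<turnstile> Neg p"
  by (simp add: Neg_def proves.ImpI)

lemma proves_NegE: "G \<turnstile> Neg p \<Longrightarrow> G \<turnstile> p \<Longrightarrow> G \<turnstile> q"
  unfolding Neg_def by (meson proves.Contr proves.ImpE proves_mono subset_insertI)

text \<open>Expresses that \<open>v\<close> is not free in \<open>p\<close> without computing free
  variables: the result of a renaming does not depend on its value at \<open>v\<close>.\<close>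

definition fresh :: "nat \<Rightarrow> fm \<Rightarrow> bool" where
  "fresh v p \<longleftrightarrow> (\<forall>f g. (\<forall>i. i \<noteq> v \<longrightarrow> f i = g i) \<longrightarrow> rename f p = rename g p)"

lemma scope_mono: "scope n p \<Longrightarrow> n \<le> m \<Longrightarrow> scope m p"
  by (induction p arbitrary: n m) force+

lemma scope_exists: "\<exists>n. scope n p"
proof (induction p)
  case (Mem x y) then show ?case by (intro exI[of _ "Suc (x + y)"]) simp
next
  case (Eq x y) then show ?case by (intro exI[of _ "Suc (x + y)"]) simp
next
  case (Imp p q)
  then obtain n m where "scope n p" "scope m q" by blast
  then show ?case by (intro exI[of _ "n + m"]) (auto intro: scope_mono)
next
  case (Forall p)
  then obtain n where "scope n p" by blast
  then show ?case by (intro exI[of _ n]) (auto intro: scope_mono)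
qed auto

lemma rename_cong: "scope n p \<Longrightarrow> (\<And>i. i < n \<Longrightarrow> f i = g i) \<Longrightarrow> rename f p = rename g p"
proof (induction p arbitrary: n f g)
  case (Forall p)
  have "rename (case_nat 0 (\<lambda>i. Suc (f i))) p = rename (case_nat 0 (\<lambda>i. Suc (g i))) p"
    by (rule Forall.IH[of "Suc n"]) (use Forall.prems in \<open>auto split: nat.split\<close>)
  then show ?case by simp
next
  case (Imp p q)
  then show ?case by (metis rename.simps(4) scope.simps(4))
qed auto

lemma fresh_if_scope: "scope n p \<Longrightarrow> n \<le> v \<Longrightarrow> fresh v p"
  unfolding fresh_def by (metis rename_cong leD)

text \<open>The eigenvariable form of \<open>ForallI\<close>, with a fresh named variable in place
  of index 0 over a shifted context.\<close>

lemma proves_generalize: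
  assumes "G \<turnstile> rename (case_nat v id) p" "\<And>q. q \<in> G \<Longrightarrow> fresh v q" "fresh v (Forall p)"
  shows "G \<turnstile> Forall p"
proof -
  \<comment> \<open>This map turns \<open>v\<close> into index 0 and shifts the rest. On formulas in
    which \<open>v\<close> is fresh it acts as \<open>Suc\<close>, and it takes the instance of
    \<open>p\<close> at \<open>v\<close> back to \<open>p\<close>.\<close>
  define f where "f i = (if i = v then 0 else Suc i)" for i
  have "rename f q = rename Suc q" if "q \<in> G" for q
    using assms(2)[OF that] by (auto simp: fresh_def f_def)
  then have G: "rename f ` G = rename Suc ` G" by (auto simp: image_iff)
  have "rename f (Forall p) = rename Suc (Forall p)"
    using assms(3) unfolding fresh_def by (metis f_def)
  then have "rename (case_nat 0 id) (rename (case_nat 0 (\<lambda>i. Suc (f i))) p) =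
      rename (case_nat 0 id) (rename (case_nat 0 (\<lambda>i. Suc (Suc i))) p)"
    by simp
  also have "\<dots> = p"
    unfolding rename_rename by (rule rename_id) (simp split: nat.split)
  finally have "rename f (rename (case_nat v id) p) = p"
    by (simp add: rename_subst f_def)
  then show ?thesis
    using proves_rename[OF assms(1), of f] by (simp add: G proves.ForallI)
qed

section \<open>Tarski semantics and the construction of Henkin sets\<close>

primrec sat :: "'a set \<Rightarrow> ('a \<Rightarrow> 'a \<Rightarrow> bool) \<Rightarrow> (nat \<Rightarrow> 'a) \<Rightarrow> fm \<Rightarrow> bool" where
  "sat D E e (Mem x y) \<longleftrightarrow> E (e x) (e y)"
| "sat D E e (Eq x y) \<longleftrightarrow> e x = e y"
| "sat D E e Falsum \<longleftrightarrow> False"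
| "sat D E e (Imp p q) \<longleftrightarrow> (sat D E e p \<longrightarrow> sat D E e q)"
| "sat D E e (Forall p) \<longleftrightarrow> (\<forall>a\<in>D. sat D E (case_nat a e) p)"

instance fm :: countable
  by countable_datatype

text \<open>For a universal formula, \<open>Neg (wit v p)\<close> says that \<open>v\<close> is a
  counterexample. Other formulas are their own witness instance, so that \<open>extend\<close> needs
  no case distinction on the shape of \<open>p\<close>.\<close>

definition wit :: "nat \<Rightarrow> fm \<Rightarrow> fm" where
  "wit v p = (case p of Forall q \<Rightarrow> rename (case_nat v id) q | _ \<Rightarrow> p)"

text \<open>One Lindenbaum-Henkin step: decide \<open>p\<close>, and if it is refuted, name a
  counterexample by a variable fresh for everything present.\<close>

definition extend :: "fm set \<Rightarrow> fm \<Rightarrow> fm set" where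
  "extend X p =
    (if insert p X \<turnstile> Falsum
     then X \<union> {Neg p, Neg (wit (SOME v. \<forall>q\<in>insert p X. fresh v q) p)}
     else insert p X)"

primrec henkin_chain :: "fm set \<Rightarrow> nat \<Rightarrow> fm set" where
  "henkin_chain X 0 = X"
| "henkin_chain X (Suc n) = extend (henkin_chain X n) (from_nat n)"

text \<open>The supply of witnesses. It survives the addition of single formulas, since each has
  only finitely many free variables.\<close>

definition odd_free :: "fm set \<Rightarrow> bool" where
  "odd_free X \<longleftrightarrow> (\<exists>n. \<forall>v\<ge>n. odd v \<longrightarrow> (\<forall>q\<in>X. fresh v q))"

lemma odd_free_insert: "odd_free X \<Longrightarrow> odd_free (insert p X)"
proof -
  assume "odd_free X"
  then obtain n where n: "\<And>v q. v \<ge> n \<Longrightarrow> odd v \<Longrightarrow> q \<in> X \<Longrightarrow> fresh v q"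
    by (auto simp: odd_free_def)
  obtain m where m: "scope m p" using scope_exists by blast
  show "odd_free (insert p X)"
    unfolding odd_free_def
    by (rule exI[of _ "n + m"]) (use n fresh_if_scope[OF m] in auto)
qed

lemma odd_free_extend: "odd_free X \<Longrightarrow> odd_free (extend X p)"
  by (simp add: extend_def odd_free_insert)

text \<open>If \<open>p\<close> is inconsistent with \<open>X\<close>, then \<open>X\<close> proves
  \<open>Neg p\<close>. Were the witness inconsistent too, \<open>X\<close> would prove the instance
  of \<open>p\<close> at a fresh variable, hence \<open>p\<close> by generalisation.\<close>

lemma extend_consistent:
  assumes "\<not> X \<turnstile> Falsum" "odd_free X"
  shows "\<not> extend X p \<turnstile> Falsum"
proof (cases "insert p X \<turnstile> Falsum")
  case True
  define v where "v = (SOME v. \<forall>q\<in>insert p X. fresh v q)"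
  obtain n where n: "\<And>v. v \<ge> n \<Longrightarrow> odd v \<Longrightarrow> \<forall>q\<in>insert p X. fresh v q"
    using odd_free_insert[OF assms(2), of p] unfolding odd_free_def by blast
  \<comment> \<open>An odd number beyond the bound \<open>n\<close>, which shows that the choice of
    \<open>v\<close> is justified.\<close>
  have "\<forall>q\<in>insert p X. fresh (2 * n + 1) q"
    by (rule n) auto
  then have v: "\<forall>q\<in>insert p X. fresh v q"
    unfolding v_def by (rule someI)
  have neg: "X \<turnstile> Neg p" using True by (rule proves_NegI)
  show ?thesis
  proof
    assume "extend X p \<turnstile> Falsum"
    then have "insert (Neg p) (insert (Neg (wit v p)) X) \<turnstile> Falsum"
      using True by (simp add: extend_def v_def)
    then have "insert (Neg (wit v p)) X \<turnstile> Falsum"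
      using neg by (meson proves_cut proves_mono subset_insertI)
    then have w: "X \<turnstile> wit v p" by (rule proves.Contr)
    have "X \<turnstile> p"
    proof (cases p)
      case (Forall q)
      then show ?thesis using w v by (auto simp: wit_def intro: proves_generalize)
    qed (use w in \<open>simp_all add: wit_def\<close>)
    then show False using neg assms(1) proves_NegE by blast
  qed
qed (simp add: extend_def)

lemma extend_superset: "X \<subseteq> extend X p"
  by (auto simp: extend_def)

lemma henkin_chain_mono: "n \<le> m \<Longrightarrow> henkin_chain X n \<subseteq> henkin_chain X m"
  by (rule lift_Suc_mono_le) (simp_all add: extend_superset)

text \<open>The union of the chain works: a derivation of \<open>Falsum\<close> would already be
  available at a finite stage.\<close>

lemma henkin_extension:
  assumes "\<not> X \<turnstile> Falsum" "odd_free X"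
  obtains H where "X \<subseteq> H" "\<not> H \<turnstile> Falsum"
    "\<And>p. p \<in> H \<or> Neg p \<in> H \<and> (\<exists>v. Neg (wit v p) \<in> H)"
proof
  let ?H = "\<Union>n. henkin_chain X n"
  have odd: "odd_free (henkin_chain X n)" for n
    by (induction n) (simp_all add: assms odd_free_extend)
  have con: "\<not> henkin_chain X n \<turnstile> Falsum" for n
    by (induction n) (simp_all add: assms odd extend_consistent)
  show "X \<subseteq> ?H" by (metis UN_upper UNIV_I henkin_chain.simps(1))
  show "\<not> ?H \<turnstile> Falsum"
  proof
    assume "?H \<turnstile> Falsum"
    then obtain F where F: "finite F" "F \<subseteq> ?H" "F \<turnstile> Falsum" using proves_finite by blast
    have "\<exists>n. F \<subseteq> henkin_chain X n"
      using F(1,2)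
    proof (induction F rule: finite_induct)
      case (insert p F)
      then obtain n m where "F \<subseteq> henkin_chain X n" "p \<in> henkin_chain X m" by blast
      then show ?case
        using henkin_chain_mono[of n "max n m" X] henkin_chain_mono[of m "max n m" X]
        by (intro exI[of _ "max n m"]) auto
    qed simp
    then show False using con F(3) proves_mono by blast
  qed
  have "extend (henkin_chain X n) (from_nat n) \<subseteq> ?H" for n
    by (metis UN_upper UNIV_I henkin_chain.simps(2))
  \<comment> \<open>Every formula is decided at the stage numbered by its code.\<close>
  then have sub: "\<exists>Y. extend Y p \<subseteq> ?H" for p
    by (metis from_nat_to_nat)
  have ext: "p \<in> extend Y p \<or> Neg p \<in> extend Y p \<and> (\<exists>v. Neg (wit v p) \<in> extend Y p)" for Y p
    unfolding extend_def by (cases "insert p Y \<turnstile> Falsum") auto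
  have "p \<in> H \<or> Neg p \<in> H \<and> (\<exists>v. Neg (wit v p) \<in> H)" if "extend Y p \<subseteq> H" for p H Y
    using that ext[of p Y] by blast
  then show "p \<in> ?H \<or> Neg p \<in> ?H \<and> (\<exists>v. Neg (wit v p) \<in> ?H)" for p
    using sub[of p] by metis
qed

text \<open>The term model: variables modulo the equalities in \<open>H\<close>. Variables are the
  only terms, so every element is some \<open>c v\<close> and quantifiers range over variables. The
  truth lemma is proved for all renamings \<open>f\<close> at once, since a quantifier changes
  \<open>f\<close> to \<open>case_nat v f\<close>.\<close>

lemma henkin_model:
  assumes con: "\<not> H \<turnstile> Falsum"
    and henkin: "\<And>p. p \<in> H \<or> Neg p \<in> H \<and> (\<exists>v. Neg (wit v p) \<in> H)"
  obtains D :: "nat set set" and E c where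
    "\<And>x y. E x y \<Longrightarrow> x \<in> D \<and> y \<in> D" "\<And>i. c i \<in> D"
    "\<And>f p. sat D E (c \<circ> f) p \<longleftrightarrow> rename f p \<in> H"
proof -
  have closed: "p \<in> H" if "H \<turnstile> p" for p
    using that henkin[of p] con by (meson proves.Assm proves_NegE)
  have refl: "Eq x x \<in> H" for x
    by (rule closed) (rule proves.EqI)
  have repl: "rename (case_nat y id) p \<in> H" if "Eq x y \<in> H" "rename (case_nat x id) p \<in> H" for x y p
    using that by (meson closed proves.Assm proves.EqE)
  \<comment> \<open>In these instances of \<open>repl\<close>, index 0 marks the place of the
    exchange; the variables that stay are shifted, as the substitution lowers them again.\<close>
  have sym: "Eq y x \<in> H" if "Eq x y \<in> H" for x y
    using repl[of x y "Eq 0 (Suc x)"] that refl by simp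
  have trans: "Eq x z \<in> H" if "Eq x y \<in> H" "Eq y z \<in> H" for x y z
    using repl[of y z "Eq (Suc x) 0"] that by simp
  have mem: "Mem x' y' \<in> H" if "Mem x y \<in> H" "Eq x x' \<in> H" "Eq y y' \<in> H" for x y x' y'
    using repl[of x x' "Mem 0 (Suc y)"] repl[of y y' "Mem (Suc x') 0"] that by simp
  have Imp: "Imp p q \<in> H \<longleftrightarrow> (p \<in> H \<longrightarrow> q \<in> H)" for p q
  proof
    assume "Imp p q \<in> H"
    then show "p \<in> H \<longrightarrow> q \<in> H" by (meson closed proves.Assm proves.ImpE)
  next
    assume "p \<in> H \<longrightarrow> q \<in> H"
    moreover have "H \<turnstile> Imp p q" if "q \<in> H"
      using that by (auto intro: proves.ImpI proves.Assm)
    moreover have "H \<turnstile> Imp p q" if "p \<notin> H"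
    proof (rule proves.ImpI)
      have "Neg p \<in> H" using that henkin by blast
      then show "insert p H \<turnstile> q" by (auto intro: proves_NegE proves.Assm)
    qed
    ultimately show "Imp p q \<in> H" using closed by blast
  qed
  \<comment> \<open>From right to left, if \<open>Forall p\<close> were missing, the Henkin property
    would put a negated instance into \<open>H\<close>, against consistency.\<close>
  have All: "Forall p \<in> H \<longleftrightarrow> (\<forall>v. rename (case_nat v id) p \<in> H)" for p
  proof
    assume "Forall p \<in> H"
    then show "\<forall>v. rename (case_nat v id) p \<in> H" by (meson closed proves.Assm proves.ForallE)
  next
    assume "\<forall>v. rename (case_nat v id) p \<in> H"
    then show "Forall p \<in> H"
      using henkin[of "Forall p"] con by (auto simp: wit_def) (meson proves.Assm proves_NegE)
  qed
  define c where "c x = {y. Eq x y \<in> H}" for x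
  define E where "E X Y \<longleftrightarrow> (\<exists>x y. X = c x \<and> Y = c y \<and> Mem x y \<in> H)" for X Y
  have c_eq: "c x = c y \<longleftrightarrow> Eq x y \<in> H" for x y
    unfolding c_def using refl sym trans by blast
  have E_c: "E (c x) (c y) \<longleftrightarrow> Mem x y \<in> H" for x y
    unfolding E_def c_eq using mem[of _ _ x y] refl sym by meson
  show thesis
  proof
    show "E x y \<Longrightarrow> x \<in> range c \<and> y \<in> range c" for x y by (auto simp: E_def)
    show "c i \<in> range c" for i by simp
    show "sat (range c) E (c \<circ> f) p \<longleftrightarrow> rename f p \<in> H" for f p
    proof (induction p arbitrary: f)
      case Falsum
      then show ?case using con by (auto intro: proves.Assm)
    next
      case (Forall p)
      have "case_nat (c v) (c \<circ> f) = c \<circ> case_nat v f" for v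
        by (auto simp: fun_eq_iff split: nat.split)
      moreover have "rename (case_nat v id) (rename (case_nat 0 (\<lambda>i. Suc (f i))) p)
          = rename (case_nat v f) p" for v
        unfolding rename_rename
        by (rule arg_cong[where f = "\<lambda>h. rename h p"]) (auto simp: fun_eq_iff split: nat.split)
      moreover have "(\<forall>a\<in>range c. P a) \<longleftrightarrow> (\<forall>v. P (c v))" for P by blast
      ultimately show ?case by (simp only: sat.simps rename.simps All Forall)
    qed (simp_all add: c_eq E_c Imp)
  qed
qed

text \<open>Contraposition: an unprovable \<open>p\<close> leaves \<open>Neg p\<close> consistent
  with \<open>G\<close>, and a Henkin extension has a term model. Its elements are sets of
  variables, so models on \<open>nat set\<close> suffice.\<close>

theorem completeness:
  assumes "\<And>(D :: nat set set) E e. (\<And>x y. E x y \<Longrightarrow> x \<in> D \<and> y \<in> D) \<Longrightarrow> (\<And>i. e i \<in> D) \<Longrightarrow>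
    (\<And>q. q \<in> G \<Longrightarrow> sat D E e q) \<Longrightarrow> sat D E e p"
  shows "G \<turnstile> p"
proof (rule ccontr)
  assume "\<not> G \<turnstile> p"
  then have con: "\<not> insert (Neg p) G \<turnstile> Falsum" using proves.Contr by blast
  \<comment> \<open>Doubling the indices frees the odd variables for use as witnesses.\<close>
  define X where "X = rename (\<lambda>i. 2 * i) ` insert (Neg p) G"
  \<comment> \<open>Halving undoes doubling, so a contradiction derived from \<open>X\<close> would
    rename to one from the original set.\<close>
  have "rename (\<lambda>i. i div 2) (rename (\<lambda>i. 2 * i) q) = q" for q
    by (simp add: rename_rename rename_id)
  then have "rename (\<lambda>i. i div 2) ` X = insert (Neg p) G"
    unfolding X_def image_image by simp
  then have conX: "\<not> X \<turnstile> Falsum"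
    using con proves_rename[of X Falsum "\<lambda>i. i div 2"] by auto
  have "fresh v q" if "odd v" and qX: "q \<in> X" for v q
  proof -
    obtain q' where q: "q = rename (\<lambda>i. 2 * i) q'" using qX X_def by blast
    have "f \<circ> (\<lambda>i. 2 * i) = g \<circ> (\<lambda>i. 2 * i)" if "\<forall>i. i \<noteq> v \<longrightarrow> f i = g i" for f g :: "nat \<Rightarrow> nat"
    proof
      fix i
      have "2 * i \<noteq> v" using \<open>odd v\<close> by auto
      then show "(f \<circ> (\<lambda>i. 2 * i)) i = (g \<circ> (\<lambda>i. 2 * i)) i" using that by simp
    qed
    then show ?thesis unfolding fresh_def q rename_rename by metis
  qed
  then have "odd_free X" unfolding odd_free_def by blast
  with conX obtain H where H: "X \<subseteq> H" "\<not> H \<turnstile> Falsum"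
    "\<And>p. p \<in> H \<or> Neg p \<in> H \<and> (\<exists>v. Neg (wit v p) \<in> H)"
    by (rule henkin_extension) blast
  obtain D :: "nat set set" and E c where M: "\<And>x y. E x y \<Longrightarrow> x \<in> D \<and> y \<in> D" "\<And>i. c i \<in> D"
    "\<And>f p. sat D E (c \<circ> f) p \<longleftrightarrow> rename f p \<in> H"
    by (rule henkin_model[OF H(2,3)]) (rule that; assumption)
  have sat: "sat D E (c \<circ> (\<lambda>i. 2 * i)) q" if "q \<in> insert (Neg p) G" for q
    using that H(1) unfolding M(3) X_def by blast
  then have "sat D E (c \<circ> (\<lambda>i. 2 * i)) p"
    using assms[of E D "c \<circ> (\<lambda>i. 2 * i)"] M(1,2) by simp
  moreover have "\<not> sat D E (c \<circ> (\<lambda>i. 2 * i)) p"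
    using sat[of "Neg p"] by (simp add: Neg_def)
  ultimately show False by blast
qed


section \<open>Evaluating formulas in a model\<close>

lemma sat_connectives [simp]:
  "sat D E e (Neg p) \<longleftrightarrow> \<not> sat D E e p"
  "sat D E e (And p q) \<longleftrightarrow> sat D E e p \<and> sat D E e q"
  "sat D E e (Or p q) \<longleftrightarrow> sat D E e p \<or> sat D E e q"
  "sat D E e (Iff p q) \<longleftrightarrow> (sat D E e p \<longleftrightarrow> sat D E e q)"
  "sat D E e (Exists p) \<longleftrightarrow> (\<exists>a\<in>D. sat D E (case_nat a e) p)"
  by (auto simp: Neg_def And_def Or_def Iff_def Exists_def)

text \<open>The value of de Bruijn level \<open>x\<close> at depth \<open>d\<close>. Passing a
  quantifier gives the new level \<open>d\<close> the head of the environment and leaves the older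
  levels unchanged.\<close>

definition val :: "(nat \<Rightarrow> 'a) \<Rightarrow> nat \<Rightarrow> nat \<Rightarrow> 'a" where
  "val e d x = e (d - Suc x)"

lemma val_case_nat [simp]:
  "val (case_nat a e) (Suc d) d = a"
  "x < d \<Longrightarrow> val (case_nat a e) (Suc d) x = val e d x"
proof -
  show "val (case_nat a e) (Suc d) d = a" by (simp add: val_def)
  show "val (case_nat a e) (Suc d) x = val e d x" if "x < d"
  proof -
    have "d - x = Suc (d - Suc x)" using that by simp
    then show ?thesis by (simp add: val_def)
  qed
qed

lemma sat_form [simp]:
  "sat D E e ((x \<^bold>\<in> y) d) \<longleftrightarrow> E (val e d x) (val e d y)"
  "sat D E e ((x \<^bold>= y) d) \<longleftrightarrow> val e d x = val e d y"
  "sat D E e (\<^bold>\<bottom> d) \<longleftrightarrow> False"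
  "sat D E e ((\<^bold>\<not> P) d) \<longleftrightarrow> \<not> sat D E e (P d)"
  "sat D E e ((P \<^bold>\<and> Q) d) \<longleftrightarrow> sat D E e (P d) \<and> sat D E e (Q d)"
  "sat D E e ((P \<^bold>\<or> Q) d) \<longleftrightarrow> sat D E e (P d) \<or> sat D E e (Q d)"
  "sat D E e ((P \<^bold>\<longrightarrow> Q) d) \<longleftrightarrow> (sat D E e (P d) \<longrightarrow> sat D E e (Q d))"
  "sat D E e ((P \<^bold>\<longleftrightarrow> Q) d) \<longleftrightarrow> (sat D E e (P d) \<longleftrightarrow> sat D E e (Q d))"
  "sat D E e (fAll A d) \<longleftrightarrow> (\<forall>a\<in>D. sat D E (case_nat a e) (A d (Suc d)))"
  "sat D E e (fEx A d) \<longleftrightarrow> (\<exists>a\<in>D. sat D E (case_nat a e) (A d (Suc d)))"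
  by (simp_all add: fMem_def fEq_def fFalse_def fNot_def fAnd_def fOr_def fImp_def fIff_def
      fAll_def fEx_def val_def)

lemma sat_rename: "sat D E e (rename f p) \<longleftrightarrow> sat D E (e \<circ> f) p"
proof (induction p arbitrary: e f)
  case (Forall p)
  have "case_nat a e \<circ> case_nat 0 (\<lambda>i. Suc (f i)) = case_nat a (e \<circ> f)" for a
    by (auto simp: fun_eq_iff split: nat.split)
  then show ?case by (simp only: rename.simps sat.simps Forall)
qed auto

text \<open>Index \<open>Suc j\<close> of \<open>p\<close> is the parameter of level
  \<open>j\<close>, so the parameters are read through the environment
  \<open>val e d\<close>.\<close>

lemma sat_inst1: "sat D E e (inst p [x] d) \<longleftrightarrow> sat D E (case_nat (val e d x) (val e d)) p"
proof -
  have "e \<circ> (\<lambda>i. d - Suc (if i < length [x] then [x] ! i else i - length [x]))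
      = case_nat (val e d x) (val e d)"
    by (auto simp: fun_eq_iff val_def split: nat.split)
  then show ?thesis by (simp add: inst_def sat_rename)
qed

section \<open>Set-theoretic notions as predicates on a model\<close>

locale membership =
  fixes D :: "'a set" and E :: "'a \<Rightarrow> 'a \<Rightarrow> bool"
  assumes E_dom: "E x y \<Longrightarrow> x \<in> D \<and> y \<in> D"
begin

definition Subset where "Subset x y \<longleftrightarrow> (\<forall>z\<in>D. E z x \<longrightarrow> E z y)"
definition Empty where "Empty x \<longleftrightarrow> (\<forall>z\<in>D. \<not> E z x)"
definition Upair where "Upair p x y \<longleftrightarrow> (\<forall>z\<in>D. E z p \<longleftrightarrow> z = x \<or> z = y)"
definition Pair where
  "Pair p x y \<longleftrightarrow> (\<exists>u\<in>D. \<exists>v\<in>D. Upair u x x \<and> Upair v x y \<and> Upair p u v)"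
definition Pair_in where "Pair_in x y r \<longleftrightarrow> (\<exists>p\<in>D. Pair p x y \<and> E p r)"
definition Succ where "Succ y x \<longleftrightarrow> (\<forall>z\<in>D. E z y \<longleftrightarrow> E z x \<or> z = x)"
definition Ordinal where
  "Ordinal x \<longleftrightarrow> (\<forall>y\<in>D. E y x \<longrightarrow> Subset y x) \<and> (\<forall>y\<in>D. E y x \<longrightarrow> \<not> E y y)
     \<and> (\<forall>y\<in>D. \<forall>z\<in>D. \<forall>w\<in>D. E y x \<and> E z x \<and> E w x \<and> E y z \<and> E z w \<longrightarrow> E y w)
     \<and> (\<forall>y\<in>D. \<forall>z\<in>D. E y x \<and> E z x \<longrightarrow> E y z \<or> y = z \<or> E z y)"
definition Natural where
  "Natural x \<longleftrightarrow>
     Ordinal x \<and> (\<forall>y\<in>D. E y x \<or> y = x \<longrightarrow> Empty y \<or> (\<exists>z\<in>D. E z y \<and> Succ y z))"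
definition Rel where
  "Rel r X Y \<longleftrightarrow> (\<forall>p\<in>D. E p r \<longrightarrow> (\<exists>x\<in>D. \<exists>y\<in>D. E x X \<and> E y Y \<and> Pair p x y))"
definition Func where
  "Func f X Y \<longleftrightarrow> Rel f X Y \<and>
     (\<forall>x\<in>D. E x X \<longrightarrow> (\<exists>y\<in>D. Pair_in x y f \<and> (\<forall>z\<in>D. Pair_in x z f \<longrightarrow> z = y)))"
primrec Num where
  "Num 0 x \<longleftrightarrow> Empty x"
| "Num (Suc k) x \<longleftrightarrow> (\<exists>y\<in>D. Num k y \<and> Succ x y)"
definition Tagged where "Tagged k c x \<longleftrightarrow> (\<exists>t\<in>D. Num k t \<and> Pair c t x)"
definition Tagged2 where "Tagged2 k c x y \<longleftrightarrow> (\<exists>p\<in>D. Pair p x y \<and> Tagged k c p)"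
definition Denotes where
  "Denotes I s t m \<longleftrightarrow>
     (\<exists>i\<in>D. Tagged 0 t i \<and> Pair_in i m s) \<or> (\<exists>a\<in>D. Tagged 1 t a \<and> Pair_in a m I)"

text \<open>This rule and its companions below trade formulas for predicates on values. The
  conditions \<open>< d\<close> say that the variables are bound further out, so their values
  survive the inner quantifiers.\<close>

lemma sat_Subset [simp]: "x < d \<Longrightarrow> y < d \<Longrightarrow>
    sat D E e (is_subset x y d) \<longleftrightarrow> Subset (val e d x) (val e d y)"
  by (simp add: is_subset_def Subset_def)

lemma sat_Empty [simp]: "x < d \<Longrightarrow> sat D E e (is_empty x d) \<longleftrightarrow> Empty (val e d x)"
  by (simp add: is_empty_def Empty_def)

lemma sat_Upair [simp]: "p < d \<Longrightarrow> x < d \<Longrightarrow> y < d \<Longrightarrow>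
    sat D E e (is_upair p x y d) \<longleftrightarrow> Upair (val e d p) (val e d x) (val e d y)"
  by (simp add: is_upair_def Upair_def)

lemma sat_Pair [simp]: "p < d \<Longrightarrow> x < d \<Longrightarrow> y < d \<Longrightarrow>
    sat D E e (is_pair p x y d) \<longleftrightarrow> Pair (val e d p) (val e d x) (val e d y)"
  by (simp add: is_pair_def Pair_def)

lemma sat_Pair_in [simp]: "r < d \<Longrightarrow> x < d \<Longrightarrow> y < d \<Longrightarrow>
    sat D E e (pair_in x y r d) \<longleftrightarrow> Pair_in (val e d x) (val e d y) (val e d r)"
  by (simp add: pair_in_def Pair_in_def)

lemma sat_Succ [simp]: "x < d \<Longrightarrow> y < d \<Longrightarrow>
    sat D E e (is_succ y x d) \<longleftrightarrow> Succ (val e d y) (val e d x)"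
  by (simp add: is_succ_def Succ_def)

lemma sat_Natural [simp]: "x < d \<Longrightarrow> sat D E e (is_Nat x d) \<longleftrightarrow> Natural (val e d x)"
  by (simp add: is_Nat_def Natural_def is_Ord_def Ordinal_def)

lemma sat_Rel [simp]: "r < d \<Longrightarrow> X < d \<Longrightarrow> Y < d \<Longrightarrow>
    sat D E e (is_rel r X Y d) \<longleftrightarrow> Rel (val e d r) (val e d X) (val e d Y)"
  by (simp add: is_rel_def Rel_def)

lemma sat_Func [simp]: "f < d \<Longrightarrow> X < d \<Longrightarrow> Y < d \<Longrightarrow>
    sat D E e (is_fun f X Y d) \<longleftrightarrow> Func (val e d f) (val e d X) (val e d Y)"
  by (simp add: is_fun_def Func_def)

lemma sat_Num [simp]: "x < d \<Longrightarrow> sat D E e (is_num k x d) \<longleftrightarrow> Num k (val e d x)"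
  by (induction k arbitrary: x d e) simp_all

lemma sat_Tagged [simp]: "c < d \<Longrightarrow> x < d \<Longrightarrow>
    sat D E e (is_tagged k c x d) \<longleftrightarrow> Tagged k (val e d c) (val e d x)"
  by (simp add: is_tagged_def Tagged_def)

lemma sat_Tagged2 [simp]: "c < d \<Longrightarrow> x < d \<Longrightarrow> y < d \<Longrightarrow>
    sat D E e (is_tagged2 k c x y d) \<longleftrightarrow> Tagged2 k (val e d c) (val e d x) (val e d y)"
  by (simp add: is_tagged2_def Tagged2_def)

lemma sat_Denotes [simp]: "I < d \<Longrightarrow> s < d \<Longrightarrow> t < d \<Longrightarrow> m < d \<Longrightarrow>
    sat D E e (denotes I s t m d)
      \<longleftrightarrow> Denotes (val e d I) (val e d s) (val e d t) (val e d m)"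
  by (simp add: denotes_def Denotes_def code_var_def code_const_def)

end

section \<open>Subsets as structures\<close>

locale pairing_model = membership +
  assumes ext: "x \<in> D \<Longrightarrow> y \<in> D \<Longrightarrow> (\<And>z. z \<in> D \<Longrightarrow> E z x \<longleftrightarrow> E z y) \<Longrightarrow> x = y"
    and empty_exists: "\<exists>x\<in>D. Empty x"
    and upair_exists: "x \<in> D \<Longrightarrow> y \<in> D \<Longrightarrow> \<exists>p\<in>D. Upair p x y"

lemma (in membership) pairing_modelI:
  assumes "sat D E e Extensionality" "sat D E e Empty_Set" "sat D E e Pairing"
  shows "pairing_model D E"
  by unfold_locales (use assms in \<open>simp_all add: Extensionality_def Empty_Set_def Pairing_def\<close>)

section \<open>Empty set, pairs and numerals as functions on the domain\<close>

context pairing_model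
begin

definition emp where "emp = (SOME x. x \<in> D \<and> Empty x)"
definition up where "up x y = (SOME p. p \<in> D \<and> Upair p x y)"
definition pr where "pr x y = up (up x x) (up x y)"
definition one where "one = up emp emp"

lemma emp: "emp \<in> D \<and> Empty emp"
  unfolding emp_def by (rule someI_ex) (use empty_exists in blast)

lemma emp_D [simp]: "emp \<in> D"
  and not_E_emp [simp]: "\<not> E z emp"
  using emp E_dom by (auto simp: Empty_def)

lemma up: "x \<in> D \<Longrightarrow> y \<in> D \<Longrightarrow> up x y \<in> D \<and> Upair (up x y) x y"
  unfolding up_def by (rule someI_ex) (use upair_exists in blast)

lemma up_D [simp]: "x \<in> D \<Longrightarrow> y \<in> D \<Longrightarrow> up x y \<in> D"
  using up by blast

lemma E_up [simp]: "x \<in> D \<Longrightarrow> y \<in> D \<Longrightarrow> E z (up x y) \<longleftrightarrow> z = x \<or> z = y"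
  using up[of x y] E_dom[of z "up x y"] by (auto simp: Upair_def)

lemma pr_D [simp]: "x \<in> D \<Longrightarrow> y \<in> D \<Longrightarrow> pr x y \<in> D"
  by (simp add: pr_def)

lemma one_D [simp]: "one \<in> D"
  by (simp add: one_def)

lemma E_one [simp]: "E z one \<longleftrightarrow> z = emp"
  by (simp add: one_def)

lemma Empty_iff [simp]: "x \<in> D \<Longrightarrow> Empty x \<longleftrightarrow> x = emp"
  using ext[of x emp] by (auto simp: Empty_def)

lemma Upair_iff [simp]: "p \<in> D \<Longrightarrow> x \<in> D \<Longrightarrow> y \<in> D \<Longrightarrow> Upair p x y \<longleftrightarrow> p = up x y"
  using ext[of p "up x y"] by (auto simp: Upair_def)

lemma Pair_iff [simp]: "p \<in> D \<Longrightarrow> x \<in> D \<Longrightarrow> y \<in> D \<Longrightarrow> Pair p x y \<longleftrightarrow> p = pr x y"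
  by (auto simp: Pair_def pr_def)

lemma Pair_in_iff [simp]: "x \<in> D \<Longrightarrow> y \<in> D \<Longrightarrow> Pair_in x y r \<longleftrightarrow> E (pr x y) r"
  by (auto simp: Pair_in_def)

lemma up_eq_iff:
  assumes "x \<in> D" "y \<in> D" "x' \<in> D" "y' \<in> D"
  shows "up x y = up x' y' \<longleftrightarrow> x = x' \<and> y = y' \<or> x = y' \<and> y = x'"
proof
  assume "up x y = up x' y'"
  then have "z = x \<or> z = y \<longleftrightarrow> z = x' \<or> z = y'" for z
    using assms by (metis E_up)
  then show "x = x' \<and> y = y' \<or> x = y' \<and> y = x'" by metis
next
  assume "x = x' \<and> y = y' \<or> x = y' \<and> y = x'"
  then show "up x y = up x' y'"
    using assms by (auto intro: ext)
qed

lemma pr_eq_iff [simp]: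
  "x \<in> D \<Longrightarrow> y \<in> D \<Longrightarrow> x' \<in> D \<Longrightarrow> y' \<in> D \<Longrightarrow> pr x y = pr x' y' \<longleftrightarrow> x = x' \<and> y = y'"
  by (auto simp: pr_def up_eq_iff)

lemma emp_neq_one [simp]: "emp \<noteq> one" "one \<noteq> emp"
  by (metis E_one not_E_emp)+

lemma Succ_one: "y \<in> D \<Longrightarrow> Succ one y \<longleftrightarrow> y = emp"
  by (auto simp: Succ_def)

text \<open>Constants and the predicate \<open>U\<close> both carry tag 1. That \<open>one\<close>
  is no other numeral therefore rules out variables and all other kinds of formulas.\<close>

lemma Num_one: "Num k one \<longleftrightarrow> k = 1"
proof (cases k)
  case (Suc l)
  have "Num l emp \<longleftrightarrow> l = 0"
    by (cases l) (auto simp: Succ_def)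
  then show ?thesis using Suc Succ_one by auto
qed simp

lemma Tagged_one:
  "x \<in> D \<Longrightarrow> y \<in> D \<Longrightarrow> Tagged k (pr one y) x \<longleftrightarrow> k = 1 \<and> x = y"
  by (auto simp: Tagged_def Num_one)

text \<open>Here \<open>x\<close> is not confined to \<open>D\<close>. The tag is read off from the
  singleton component of the Kuratowski pair.\<close>

lemma not_Tagged_one: "y \<in> D \<Longrightarrow> k \<noteq> 1 \<Longrightarrow> \<not> Tagged k (pr one y) x"
  by (auto simp: Tagged_def Pair_def pr_def up_eq_iff Num_one)

lemma not_Tagged2_one: "y \<in> D \<Longrightarrow> k \<noteq> 1 \<Longrightarrow> \<not> Tagged2 k (pr one y) x z"
  by (simp add: Tagged2_def not_Tagged_one)

section \<open>Satisfaction of the sentences \<open>U(c_b)\<close>\<close>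

lemma Natural_emp [simp]: "Natural emp"
  by (simp add: Natural_def Ordinal_def)

lemma Natural_one [simp]: "Natural one"
  by (auto simp: Natural_def Ordinal_def Subset_def Succ_def)

text \<open>With variable bound 0, the empty set is the only assignment.\<close>

lemma Func_emp [simp]: "s \<in> D \<Longrightarrow> Func s emp M \<longleftrightarrow> s = emp"
  using ext[of s emp] by (auto simp: Func_def Rel_def)

text \<open>The code of \<open>U(c_b)\<close>: the inner pair codes the constant, the outer tag is
  that of \<open>U\<close>.\<close>

definition pred_code where "pred_code b = pr one (pr one b)"

lemma pred_code_D [simp]: "b \<in> D \<Longrightarrow> pred_code b \<in> D"
  by (simp add: pred_code_def)

lemmas code_defs = code_var_def code_const_def code_eq_def code_U_def code_R_def code_neg_def
  code_conj_def code_ex_def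

lemma sat_atomic_pred_code:
  assumes "A < d" "k < d" "c < d" "val e d c = pred_code b" "E b (val e d A)"
  shows "sat D E e (is_atomic True False A k c d)"
  using assms E_dom[OF assms(5)]
  by (auto simp: is_atomic_def is_term_def code_defs pred_code_def Tagged_one
      intro!: bexI[of _ "pr one b"])

text \<open>An atomic formula is a formation sequence of length \<open>one\<close> by itself; its
  graph is the singleton holding the pair of position \<open>emp\<close> and the code.\<close>

lemma sat_formation_pred_code:
  assumes "A < d" "k < d" "n < d" "g < d" "E b (val e d A)"
    "val e d n = one" "val e d g = up (pr emp (pred_code b)) (pr emp (pred_code b))"
  shows "sat D E e (is_formation True False A k n g d)"
proof -
  have b: "b \<in> D" using E_dom assms(5) by blast
  then have "Func (up (pr emp (pred_code b)) (pr emp (pred_code b))) one (up (pred_code b) (pred_code b))"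
    by (auto simp: Func_def Rel_def)
  then have "\<exists>Y\<in>D. Func (up (pr emp (pred_code b)) (pr emp (pred_code b))) one Y"
    using b by (metis up_D pred_code_D)
  then show ?thesis
    using assms b by (auto simp: is_formation_def intro!: sat_atomic_pred_code)
qed

lemma sat_formula_pred_code:
  assumes "A < d" "k < d" "c < d" "E b (val e d A)" "val e d c = pred_code b"
  shows "sat D E e (is_formula True False A k c d)"
proof -
  let ?g = "up (pr emp (pred_code b)) (pr emp (pred_code b))"
  have b: "b \<in> D" using E_dom assms(4) by blast
  show ?thesis
    unfolding is_formula_def sat_form
    by (rule bexI[of _ one], rule bexI[of _ ?g], rule bexI[of _ emp])
      (use assms b in \<open>auto intro!: sat_formation_pred_code[where b = b]\<close>)
qed

lemma Denotes_const:
  assumes "b \<in> D" "\<And>m. m \<in> D \<Longrightarrow> E (pr b m) I \<longleftrightarrow> m = b" "m \<in> D"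
  shows "Denotes I s (pr one b) m \<longleftrightarrow> m = b"
  using assms by (auto simp: Denotes_def Tagged_one)

text \<open>At this code the tags make every Tarski clause fail except the one for \<open>U\<close>,
  and there the constant denotes \<open>b\<close> because \<open>I\<close> maps \<open>b\<close> to
  itself.\<close>

lemma sat_set_pred_codeD:
  assumes lt: "M < d" "U < d" "R < d" "I < d" "k < d" "g < d" "T < d"
    and sat: "sat D E e (is_sat_set M U R I k g T d)"
    and b: "b \<in> D" "j \<in> D" "E (pr j (pred_code b)) (val e d g)" "E (pr (pred_code b) emp) (val e d T)"
    and k: "val e d k = emp"
    and I: "\<And>m. m \<in> D \<Longrightarrow> E (pr b m) (val e d I) \<longleftrightarrow> m = b"
  shows "E b (val e d U)"
proof -
  have "\<exists>t\<in>D. \<exists>m\<in>D. Tagged 1 (pred_code b) t \<and> Denotes (val e d I) emp t m \<and> E m (val e d U)"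
    using bspec[OF bspec[OF bspec[OF sat[unfolded is_sat_set_def sat_form], of j],
        of "pred_code b"], of emp] lt b k
    by (simp add: code_defs pred_code_def not_Tagged_one not_Tagged2_one)
  then obtain t m where t: "t \<in> D" "m \<in> D" "Tagged 1 (pred_code b) t" "Denotes (val e d I) emp t m"
      "E m (val e d U)"
    by blast
  then have "t = pr one b" using b(1) by (simp add: pred_code_def Tagged_one)
  then show ?thesis using t Denotes_const[OF b(1) I] by blast
qed

text \<open>The sequence \<open>g\<close> has one entry and the only assignment is empty, so a
  one-element \<open>T\<close> meets the single condition imposed.\<close>

lemma sat_set_pred_codeI:
  assumes lt: "M < d" "U < d" "R < d" "I < d" "k < d" "g < d" "T < d"
    and vals: "val e d g = up (pr emp (pred_code b)) (pr emp (pred_code b))"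
      "val e d T = up (pr (pred_code b) emp) (pr (pred_code b) emp)"
      "val e d k = emp"
    and b: "b \<in> D" "E b (val e d U)"
    and I: "\<And>m. m \<in> D \<Longrightarrow> E (pr b m) (val e d I) \<longleftrightarrow> m = b"
  shows "sat D E e (is_sat_set M U R I k g T d)"
proof -
  have "\<exists>t\<in>D. \<exists>m\<in>D. Tagged 1 (pred_code b) t \<and> Denotes (val e d I) emp t m \<and> E m (val e d U)"
    by (rule bexI[of _ "pr one b"], rule bexI[of _ b])
      (simp_all add: b pred_code_def Tagged_one Denotes_const[OF b(1) I])
  then show ?thesis
    using lt vals b(1) by (auto simp: is_sat_set_def code_defs)
qed

lemma sat_satisfies_pred_code:
  assumes lt: "A < d" "M < d" "U < d" "R < d" "I < d" "k < d" "c < d" "s < d"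
    and b: "E b (val e d A)"
    and vals: "val e d c = pred_code b" "val e d k = emp" "val e d s = emp"
    and I: "\<And>m. m \<in> D \<Longrightarrow> E (pr b m) (val e d I) \<longleftrightarrow> m = b"
  shows "sat D E e (satisfies True False A M U R I k c s d) \<longleftrightarrow> E b (val e d U)"
proof
  have bD [simp]: "b \<in> D" using E_dom b by blast
  {
    assume "sat D E e (satisfies True False A M U R I k c s d)"
    \<comment> \<open>The four witnesses take the levels from \<open>d\<close> upwards, which puts
      \<open>g\<close> at \<open>Suc d\<close> and \<open>T\<close> three above
      \<open>d\<close>.\<close>
    then obtain n g j T where D: "n \<in> D" "g \<in> D" "j \<in> D" "T \<in> D"
      and h: "E (pr j (pred_code b)) g" "E (pr (pred_code b) emp) T"
      and sat: "sat D E (case_nat T (case_nat j (case_nat g (case_nat n e))))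
        (is_sat_set M U R I k (Suc d) (Suc (Suc (Suc d))) (Suc (Suc (Suc (Suc d)))))"
      using lt vals by (auto simp: satisfies_def)
    show "E b (val e d U)"
      using sat_set_pred_codeD[OF _ _ _ _ _ _ _ sat bD D(3)] lt vals I h by simp
  next
    let ?g = "up (pr emp (pred_code b)) (pr emp (pred_code b))"
    let ?T = "up (pr (pred_code b) emp) (pr (pred_code b) emp)"
    assume "E b (val e d U)"
    then show "sat D E e (satisfies True False A M U R I k c s d)"
      unfolding satisfies_def sat_form
      by - (rule bexI[of _ one], rule bexI[of _ ?g], rule bexI[of _ emp], rule bexI[of _ ?T],
        use lt vals b I in \<open>auto intro!: sat_formation_pred_code[where b = b]
          sat_set_pred_codeI[where b = b]\<close>)
  }
qed

text \<open>Elementarity is applied to the sentence \<open>U(c_b)\<close>, which expresses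
  \<open>b \<in> x\<close> in one structure and \<open>b \<in> x'\<close> in the other.\<close>

lemma elementary_imp_agree:
  assumes lt: "A < d" "f < d" "S < d" "S' < d"
    and sat: "sat D E e (is_elementary True False A f S S' d)"
    and vals: "val e d S = pr a (pr x i)" "val e d S' = pr a (pr x' i)" "val e d A = a"
    and D: "x \<in> D" "x' \<in> D" "i \<in> D"
    and id: "\<And>b m. b \<in> D \<Longrightarrow> m \<in> D \<Longrightarrow> E (pr b m) i \<longleftrightarrow> E b a \<and> m = b"
    and b: "E b a"
  shows "E b x \<longleftrightarrow> E b x'"
proof -
  have bD: "b \<in> D" "a \<in> D" using E_dom b by blast+
  let ?d = "Suc (Suc (Suc (Suc (Suc (Suc (Suc (Suc d)))))))"
  \<comment> \<open>The components of the two structures occupy eight levels from \<open>d\<close>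
    on, so \<open>M\<close> has level \<open>d\<close>, \<open>M'\<close> has level
    \<open>d + 4\<close>, and the next quantifier binds level \<open>?d\<close>.\<close>
  obtain M U R I M' U' R' I' where
    mem: "M \<in> D" "U \<in> D" "I \<in> D" "M' \<in> D" "U' \<in> D" "I' \<in> D"
    and S: "\<exists>p\<in>D. Pair (pr a (pr x i)) M p \<and> Pair p U I"
      "\<exists>p\<in>D. Pair (pr a (pr x' i)) M' p \<and> Pair p U' I'"
    and elem: "sat D E (case_nat I' (case_nat R' (case_nat U' (case_nat M'
        (case_nat I (case_nat R (case_nat U (case_nat M e))))))))
      ((\<^bold>\<forall>k c s s'.
          is_Nat k \<^bold>\<and> is_formula True False A k c \<^bold>\<and> is_fun s k d \<^bold>\<and> is_fun s' k (Suc (Suc (Suc (Suc d))))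
            \<^bold>\<and> (\<^bold>\<forall>i m m'. pair_in i m s \<^bold>\<and> pair_in m m' f \<^bold>\<longrightarrow> pair_in i m' s') \<^bold>\<longrightarrow>
          (satisfies True False A d (Suc d) (Suc (Suc d)) (Suc (Suc (Suc d))) k c s \<^bold>\<longleftrightarrow>
           satisfies True False A (Suc (Suc (Suc (Suc d)))) (Suc (Suc (Suc (Suc (Suc d)))))
             (Suc (Suc (Suc (Suc (Suc (Suc d)))))) (Suc (Suc (Suc (Suc (Suc (Suc (Suc d))))))) k c s'))
        ?d)"
    (is "sat D E ?e _")
    using sat lt vals
    unfolding is_elementary_def is_structure_def sat_form(5,10) if_True if_False
    by (elim bexE conjE) (simp del: sat_form(9))
  have U: "U = x" "I = i" "U' = x'" "I' = i" using S D bD mem by auto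
  \<comment> \<open>Bound 0, the code of \<open>U(c_b)\<close> and two empty assignments; the
    compatibility of the assignments with \<open>f\<close> is then vacuous.\<close>
  have *: "(sat D E (case_nat emp (case_nat emp (case_nat (pred_code b) (case_nat emp ?e))))
      (satisfies True False A d (Suc d) (Suc (Suc d)) (Suc (Suc (Suc d))) ?d (Suc ?d) (Suc (Suc ?d))
         (Suc (Suc (Suc (Suc ?d))))) \<longleftrightarrow>
    sat D E (case_nat emp (case_nat emp (case_nat (pred_code b) (case_nat emp ?e))))
      (satisfies True False A (Suc (Suc (Suc (Suc d)))) (Suc (Suc (Suc (Suc (Suc d)))))
         (Suc (Suc (Suc (Suc (Suc (Suc d)))))) (Suc (Suc (Suc (Suc (Suc (Suc (Suc d))))))) ?d (Suc ?d)
         (Suc (Suc (Suc ?d))) (Suc (Suc (Suc (Suc ?d))))))"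
    using bspec[OF bspec[OF bspec[OF bspec[OF elem[unfolded sat_form(9)], of emp], of "pred_code b"], of emp], of emp]
      lt vals b bD sat_formula_pred_code[where b = b]
    by simp
  show ?thesis
    using * lt vals b bD by (simp add: sat_satisfies_pred_code[where b = b] U id)
qed

end

text \<open>Under the quantifier, index 1 is the candidate element and index 2 the parameter. The
  quantifier has the bounded shape that \<open>delta0\<close> accepts.\<close>

definition subset_fm :: fm where
  "subset_fm = Forall (Imp (Mem 0 1) (Mem 0 2))"

lemma sat_Separation_subset:
  "sat D E e (Separation 1 subset_fm) \<longleftrightarrow>
    (\<forall>a\<in>D. \<forall>w\<in>D. \<exists>b\<in>D. \<forall>x\<in>D. E x b \<longleftrightarrow> E x w \<and> (\<forall>z\<in>D. E z x \<longrightarrow> E z a))"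
  by (simp add: Separation_def univ_def sat_inst1 subset_fm_def numeral_2_eq_2)

text \<open>Among the Kuratowski pairs \<open>{{u}, {u, v}}\<close>, those with \<open>u = v\<close> are the ones with a single element.\<close>

definition diagonal_fm :: fm where
  "diagonal_fm = Forall (Imp (Mem 0 1) (Forall (Imp (Mem 0 2) (Eq 1 0))))"

lemma sat_Separation_diagonal:
  "sat D E e (Separation 0 diagonal_fm) \<longleftrightarrow>
    (\<forall>w\<in>D. \<exists>b\<in>D. \<forall>x\<in>D. E x b \<longleftrightarrow> E x w \<and> (\<forall>u\<in>D. E u x \<longrightarrow> (\<forall>v\<in>D. E v x \<longrightarrow> u = v)))"
  by (simp add: Separation_def univ_def sat_inst1 diagonal_fm_def numeral_2_eq_2)

text \<open>The class of all \<open>\<langle>a, x, i\<rangle>\<close> with \<open>x \<subseteq> a\<close>, where the levels 0, 1, 2 stand for \<open>i\<close>, \<open>a\<close> and the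
  member of the class; under \<open>inst\<close> the parameters \<open>a\<close>, \<open>i\<close> then come in this order.\<close>

definition subset_structures_fm :: fm where
  "subset_structures_fm = (\<^bold>\<exists>x q. is_subset x 1 \<^bold>\<and> is_pair q x 0 \<^bold>\<and> is_pair 2 1 q) 3"

lemma scope_subset_structures: "scope 3 subset_structures_fm"
  by (simp add: subset_structures_fm_def is_subset_def is_pair_def is_upair_def fEx_def fAll_def
      fAnd_def fOr_def fIff_def fImp_def fMem_def fEq_def Exists_def And_def Or_def Iff_def Neg_def)

section \<open>The instance of VP for structures given by subsets\<close>

context membership
begin

lemma sat_subset_structures:
  "sat D E (case_nat s e) subset_structures_fm \<longleftrightarrow>
    (\<exists>x\<in>D. \<exists>q\<in>D. Subset x (e 0) \<and> Pair q x (e 1) \<and> Pair s (e 0) q)"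
  by (simp add: subset_structures_fm_def) (simp add: val_def numeral_2_eq_2 numeral_3_eq_3)

text \<open>The parameters \<open>a\<close> and \<open>i\<close> have levels 0 and 1, and the set of
  constants, at level 2, is \<open>a\<close> again. Hence \<open>s\<close>, \<open>s'\<close> and
  \<open>f\<close> have levels 3, 4 and 5 at depth 6. The language omits the binary predicate, so
  \<open>R\<close> is the empty dummy.\<close>

lemma sat_Vopenka_subset_structures:
  assumes "sat D E e (Vopenka True False 2 subset_structures_fm)" "a \<in> D" "i \<in> D"
    and P: "\<And>s. s \<in> D \<Longrightarrow> P s \<longleftrightarrow> (\<exists>x\<in>D. \<exists>q\<in>D. Subset x a \<and> Pair q x i \<and> Pair s a q)"
    and "\<forall>x\<in>D. \<exists>y\<in>D. P y \<and> \<not> E y x \<or> \<not> P y \<and> E y x"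
    and "\<forall>s\<in>D. P s \<longrightarrow> (\<exists>M\<in>D. \<exists>U\<in>D. \<exists>R\<in>D. \<exists>I\<in>D. (\<exists>p\<in>D. Pair s M p \<and> Pair p U I)
        \<and> (\<exists>m\<in>D. E m M) \<and> Subset U M \<and> Empty R \<and> Func I a M)"
  shows "\<exists>s\<in>D. \<exists>s'\<in>D. s \<noteq> s' \<and> P s \<and> P s' \<and>
    (\<exists>f\<in>D. sat D E (case_nat f (case_nat s' (case_nat s (case_nat a (case_nat i (case_nat a e))))))
      (is_elementary True False 2 5 3 4 6))"
proof -
  have 2: "2 = Suc (Suc 0)" and 5: "5 = Suc (Suc (Suc (Suc (Suc 0))))" and 3: "3 = Suc (Suc (Suc 0))"
    and 4: "4 = Suc (Suc (Suc (Suc 0)))" and 6: "6 = Suc (Suc (Suc (Suc (Suc (Suc 0)))))" by simp_all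
  have univ: "univ (Suc (Suc 0)) Q = Forall (Forall (Q (Suc (Suc 0))))" for Q
    by (simp add: univ_def)
  have "(\<forall>x\<in>D. \<exists>y\<in>D. P y \<and> \<not> E y x \<or> \<not> P y \<and> E y x) \<and>
    (\<forall>s\<in>D. P s \<longrightarrow> (\<exists>M\<in>D. \<exists>U\<in>D. \<exists>R\<in>D. \<exists>I\<in>D. (\<exists>p\<in>D. Pair s M p \<and> Pair p U I)
        \<and> (\<exists>m\<in>D. E m M) \<and> Subset U M \<and> Empty R \<and> Func I a M)) \<longrightarrow> ?thesis"
    using assms(1)[unfolded Vopenka_def 2 univ sat.simps, THEN bspec, OF assms(2), THEN bspec, OF assms(3)]
      assms(2)
    unfolding 2 3 4 5 6
    by (simp add: is_proper_class_def is_L_structure_def is_structure_def sat_inst1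
        sat_subset_structures P cong: ball_cong bex_cong)
  then show ?thesis using assms(5,6) by blast
qed

end

section \<open>The power set inside the model\<close>

context pairing_model
begin

lemma powerset_exists:
  assumes "sat D E e Union_Axiom" and "sat D E e Cartesian_Product"
    and sep_subset: "sat D E e (Separation 1 subset_fm)"
    and sep_diagonal: "sat D E e (Separation 0 diagonal_fm)"
    and vopenka: "sat D E e (Vopenka True False 2 subset_structures_fm)"
    and a: "a \<in> D"
  shows "\<exists>y\<in>D. \<forall>z\<in>D. E z y \<longleftrightarrow> Subset z a"
proof (cases "a = emp")
  \<comment> \<open>The empty set is treated apart because structures have nonempty universes; its
    power set is \<open>one\<close>.\<close>
  case True
  have "Subset z emp \<longleftrightarrow> z = emp" if "z \<in> D" for z
    using that ext[of z emp] by (auto simp: Subset_def)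
  then show ?thesis using True by (intro bexI[of _ one]) auto
next
  case False
  then obtain m where m: "m \<in> D" "E m a"
    using a Empty_iff[of a] unfolding Empty_def by blast
  have union: "\<forall>x\<in>D. \<exists>y\<in>D. \<forall>z\<in>D. E z y \<longleftrightarrow> (\<exists>w\<in>D. E w x \<and> E z w)"
    using assms(1) by (simp add: Union_Axiom_def)
  have product:
    "\<forall>x\<in>D. \<forall>y\<in>D. \<exists>z\<in>D. \<forall>p\<in>D. E p z \<longleftrightarrow> (\<exists>u\<in>D. \<exists>v\<in>D. E u x \<and> E v y \<and> Pair p u v)"
    using assms(2) by (simp add: Cartesian_Product_def)
  obtain aa where aa: "aa \<in> D" "\<forall>p\<in>D. E p aa \<longleftrightarrow> (\<exists>u\<in>D. \<exists>v\<in>D. E u a \<and> E v a \<and> Pair p u v)"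
    using product a by blast
  \<comment> \<open>The identity on \<open>a\<close>, separated from \<open>a \<times> a\<close> as
    the diagonal; it interprets each constant by its own index.\<close>
  obtain i where i: "i \<in> D"
    "\<forall>x\<in>D. E x i \<longleftrightarrow> E x aa \<and> (\<forall>u\<in>D. E u x \<longrightarrow> (\<forall>v\<in>D. E v x \<longrightarrow> u = v))"
    using sep_diagonal aa(1) unfolding sat_Separation_diagonal by blast
  have pr_diag: "(\<forall>u\<in>D. E u (pr b c) \<longrightarrow> (\<forall>v\<in>D. E v (pr b c) \<longrightarrow> u = v)) \<longleftrightarrow> c = b"
    if "b \<in> D" "c \<in> D" for b c
    using that by (auto simp: pr_def up_eq_iff)
  have id: "E (pr b c) i \<longleftrightarrow> E b a \<and> c = b" if "b \<in> D" "c \<in> D" for b c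
    using that i(2) aa(2) pr_diag[OF that] by auto
  have Func_i: "Func i a a"
    unfolding Func_def Rel_def
  proof (intro conjI ballI impI)
    fix p assume "p \<in> D" "E p i"
    then show "\<exists>x\<in>D. \<exists>y\<in>D. E x a \<and> E y a \<and> Pair p x y" using i(2) aa(2) by blast
  next
    fix b assume "b \<in> D" "E b a"
    then show "\<exists>y\<in>D. Pair_in b y i \<and> (\<forall>z\<in>D. Pair_in b z i \<longrightarrow> z = y)"
      using id by (intro bexI[of _ b]) auto
  qed
  let ?P = "\<lambda>s. \<exists>x\<in>D. Subset x a \<and> s = pr a (pr x i)"
  have P: "(\<exists>x\<in>D. \<exists>q\<in>D. Subset x a \<and> Pair q x i \<and> Pair s a q) \<longleftrightarrow> ?P s" if "s \<in> D" for s
    using that a i(1) by (metis Pair_iff pr_D)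
  \<comment> \<open>That no set has exactly these structures as members is literally the statement
    that they form a proper class.\<close>
  obtain Z where Z: "Z \<in> D" "\<forall>s\<in>D. E s Z \<longleftrightarrow> ?P s"
  proof (rule ccontr)
    assume "\<not> thesis"
    then have "\<forall>x\<in>D. \<exists>y\<in>D. ?P y \<and> \<not> E y x \<or> \<not> ?P y \<and> E y x"
      using that by blast
    moreover have "\<exists>M\<in>D. \<exists>U\<in>D. \<exists>R\<in>D. \<exists>I\<in>D. (\<exists>p\<in>D. Pair s M p \<and> Pair p U I)
        \<and> (\<exists>m\<in>D. E m M) \<and> Subset U M \<and> Empty R \<and> Func I a M" if "s \<in> D" "?P s" for s
      using that a i(1) Func_i m by (metis Pair_iff pr_D emp)
    ultimately have "\<exists>s\<in>D. \<exists>s'\<in>D. s \<noteq> s' \<and> ?P s \<and> ?P s' \<and>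
      (\<exists>f\<in>D. sat D E (case_nat f (case_nat s' (case_nat s (case_nat a (case_nat i (case_nat a e))))))
        (is_elementary True False 2 5 3 4 6))"
      by (intro sat_Vopenka_subset_structures[OF vopenka a i(1) P[symmetric]]) auto
    then obtain s s' f where s: "s \<in> D" "s' \<in> D" "f \<in> D" "s \<noteq> s'" "?P s" "?P s'"
      and f: "sat D E (case_nat f (case_nat s' (case_nat s (case_nat a (case_nat i (case_nat a e))))))
        (is_elementary True False 2 5 3 4 6)"
      by blast
    then obtain x x' where x: "x \<in> D" "x' \<in> D" "Subset x a" "Subset x' a" "s = pr a (pr x i)" "s' = pr a (pr x' i)"
      by blast
    \<comment> \<open>Agreement on \<open>a\<close> is enough, since both \<open>x\<close> and
      \<open>x'\<close> are subsets of \<open>a\<close>.\<close>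
    have "E b x \<longleftrightarrow> E b x'" if "E b a" for b
      by (rule elementary_imp_agree[where a = a and i = i, OF _ _ _ _ f])
        (use x a i(1) id that in \<open>simp_all add: val_def\<close>)
    then have "x = x'" using x by (intro ext) (auto simp: Subset_def)
    then show False using s(4) x by simp
  qed
  \<comment> \<open>Four unions follow the membership chain from
    \<open>\<langle>a, \<langle>x, i\<rangle>\<rangle>\<close> through
    \<open>{a, \<langle>x, i\<rangle>}\<close>, \<open>\<langle>x, i\<rangle>\<close> and
    \<open>{x}\<close> down to \<open>x\<close>. Other elements of \<open>W\<close> are removed by
    separation afterwards.\<close>
  obtain W where W: "W \<in> D" "\<And>x. x \<in> D \<Longrightarrow> Subset x a \<Longrightarrow> E x W"
  proof -
    obtain Z1 where Z1: "Z1 \<in> D" "\<forall>z\<in>D. E z Z1 \<longleftrightarrow> (\<exists>w\<in>D. E w Z \<and> E z w)" using union Z(1) by blast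
    obtain Z2 where Z2: "Z2 \<in> D" "\<forall>z\<in>D. E z Z2 \<longleftrightarrow> (\<exists>w\<in>D. E w Z1 \<and> E z w)" using union Z1(1) by blast
    obtain Z3 where Z3: "Z3 \<in> D" "\<forall>z\<in>D. E z Z3 \<longleftrightarrow> (\<exists>w\<in>D. E w Z2 \<and> E z w)" using union Z2(1) by blast
    obtain Z4 where Z4: "Z4 \<in> D" "\<forall>z\<in>D. E z Z4 \<longleftrightarrow> (\<exists>w\<in>D. E w Z3 \<and> E z w)" using union Z3(1) by blast
    have "E x Z4" if x: "x \<in> D" "Subset x a" for x
    proof -
      have "E (pr a (pr x i)) Z" using Z(2) x a i(1) by auto
      then have "E (up a (pr x i)) Z1"
        using x a i(1)
        by (intro Z1(2)[rule_format, THEN iffD2] bexI[of _ "pr a (pr x i)"]) (simp_all add: pr_def)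
      then have "E (pr x i) Z2"
        using x a i(1) by (intro Z2(2)[rule_format, THEN iffD2] bexI[of _ "up a (pr x i)"]) simp_all
      then have "E (up x x) Z3"
        using x a i(1)
        by (intro Z3(2)[rule_format, THEN iffD2] bexI[of _ "pr x i"]) (simp_all add: pr_def)
      then show ?thesis
        using x by (intro Z4(2)[rule_format, THEN iffD2] bexI[of _ "up x x"]) simp_all
    qed
    then show thesis using that Z4(1) by blast
  qed
  obtain Y where "Y \<in> D" "\<forall>x\<in>D. E x Y \<longleftrightarrow> E x W \<and> (\<forall>z\<in>D. E z x \<longrightarrow> E z a)"
    using sep_subset W(1) a unfolding sat_Separation_subset by blast
  then show ?thesis using W(2) by (auto simp: Subset_def)
qed

lemma sat_Powerset:
  assumes "sat D E e Union_Axiom" "sat D E e Cartesian_Product"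
    "sat D E e (Separation 1 subset_fm)" "sat D E e (Separation 0 diagonal_fm)"
    "sat D E e (Vopenka True False 2 subset_structures_fm)"
  shows "sat D E e Powerset"
  using powerset_exists[OF assms] by (simp add: Powerset_def)

end

text \<open>Completeness turns this into a statement about models. What is left is syntactic: the
  formulas used must meet the \<open>delta0\<close> and \<open>scope\<close> conditions of their
  schemes.\<close>

theorem EST_VP_proves_Powerset: "EST \<union> VP \<turnstile> Powerset"
proof (rule completeness)
  fix D :: "nat set set" and E e
  assume dom: "\<And>x y. E x y \<Longrightarrow> x \<in> D \<and> y \<in> D"
    and ax: "\<And>q. q \<in> EST \<union> VP \<Longrightarrow> sat D E e q"
  have m: "membership D E" by unfold_locales (rule dom)
  have "sat D E e Extensionality" "sat D E e Empty_Set" "sat D E e Pairing"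
    by (rule ax, simp add: EST_def)+
  then have pm: "pairing_model D E" by (rule membership.pairing_modelI[OF m])
  have ax': "sat D E e Union_Axiom" "sat D E e Cartesian_Product"
    by (rule ax, simp add: EST_def)+
  \<comment> \<open>Numerals are unfolded because the rule for bounded quantifiers expects an index
    of the form \<open>Suc y\<close>.\<close>
  have "delta0 subset_fm" "delta0 diagonal_fm"
    unfolding subset_fm_def diagonal_fm_def numeral_2_eq_2 One_nat_def by (intro delta0.intros)+
  moreover have "scope (Suc 1) subset_fm" "scope (Suc 0) diagonal_fm"
    by (simp_all add: subset_fm_def diagonal_fm_def)
  ultimately have "Separation 1 subset_fm \<in> EST" "Separation 0 diagonal_fm \<in> EST"
    unfolding EST_def by blast+
  moreover have "Vopenka True False 2 subset_structures_fm \<in> VP"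
    using scope_subset_structures unfolding VP_def by (auto simp: numeral_3_eq_3 numeral_2_eq_2)
  ultimately show "sat D E e Powerset"
    using ax by (intro pairing_model.sat_Powerset[OF pm ax']) blast+
qed

theorem theorem2p14:
  "EST \<union> VP \<union> Delta0_Replacement \<turnstile> Powerset \<and> EST \<union> VP \<turnstile> Powerset"
  using EST_VP_proves_Powerset proves_mono by blast

end
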